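(* Let $N\ge 3$ and $r>0$. For any $u\in\mathcal D^{1,2}(\mathbb R^N)$ the map $y\mapsto u(y)\Big(\int_{S_r}\frac{d\sigma(x)}{|x-y|^2}\Big)^{1/2}$ belongs to $L^2(\mathbb R^N)$ and $$\Big(\frac{N-2}{2}\Big)^2\int_{\mathbb R^N}|u(y)|^2\bigg(\frac1{2\pi r}\int_{S_r}\frac{d\sigma(x)}{|x-y|^2}\bigg)\,dy\le\int_{\mathbb R^N}|\nabla u(y)|^2\,dy.$$ Moreover the constant $\big(\frac{N-2}{2}\big)^2$ is optimal (it cannot be replaced by any larger constant) and not attained (equality holds for no $u\in\mathcal D^{1,2}(\mathbb R^N)\setminus\{0\}$).
   Context: $\mathcal D^{1,2}(\mathbb R^N)$ is the closure of the space $\mathcal D(\mathbb R^N)$ of smooth compactly supported functions with respect to the Dirichlet norm $\big(\int_{\mathbb R^N}|\nabla u|^2dx\big)^{1/2}$. Writing $\mathbb R^N=\mathbb R^2\times\mathbb R^{N-2}$, $S_r=\{(x,0)\in\mathbb R^2\times\mathbb R^{N-2}:|x|=r\}$ is the circle of radius $r$ in the plane $\mathbb R^2\times\{0\}$, and $d\sigma$ is the line element (arc length) on $S_r$. *)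

theory Defs
  imports "HOL-Analysis.Analysis"
begin

fun Ck :: "nat \<Rightarrow> ('a::euclidean_space \<Rightarrow> real) \<Rightarrow> bool" where
  "Ck 0 f \<longleftrightarrow> continuous_on UNIV f"
| "Ck (Suc k) f \<longleftrightarrow>
     f differentiable_on UNIV \<and> (\<forall>b\<in>Basis. Ck k (\<lambda>x. frechet_derivative f (at x) b))"

definition test_function :: "('a::euclidean_space \<Rightarrow> real) \<Rightarrow> bool" where
  "test_function \<phi> \<longleftrightarrow> (\<forall>k. Ck k \<phi>) \<and> compact (closure {x. \<phi> x \<noteq> 0})"

definition locally_integrable :: "('a::euclidean_space \<Rightarrow> 'b::euclidean_space) \<Rightarrow> bool" where
  "locally_integrable f \<longleftrightarrow> (\<forall>K. compact K \<longrightarrow> set_integrable lebesgue K f)"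

definition has_weak_gradient :: "('a::euclidean_space \<Rightarrow> real) \<Rightarrow> ('a \<Rightarrow> 'a) \<Rightarrow> bool" where
  "has_weak_gradient u g \<longleftrightarrow> locally_integrable u \<and> locally_integrable g \<and>
     (\<forall>\<phi> b. test_function \<phi> \<longrightarrow> b \<in> Basis \<longrightarrow>
        (LINT x|lebesgue. u x * frechet_derivative \<phi> (at x) b)
          = - (LINT x|lebesgue. (g x \<bullet> b) * \<phi> x))"

text \<open>A weak gradient is unique up to a null set; this picks a representative.\<close>

definition weak_gradient :: "('a::euclidean_space \<Rightarrow> real) \<Rightarrow> 'a \<Rightarrow> 'a" where
  "weak_gradient u = (SOME g. has_weak_gradient u g)"

text \<open>The square of the Dirichlet norm, possibly infinite.\<close>

definition dirichlet_energy :: "('a::euclidean_space \<Rightarrow> real) \<Rightarrow> ennreal" where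
  "dirichlet_energy u = (\<integral>\<^sup>+x. ennreal ((norm (weak_gradient u x))\<^sup>2) \<partial>lebesgue)"

text \<open>
  The closure of the test functions with respect to the Dirichlet norm, realised as a space of
  functions. The Dirichlet norm does not see additive constants, so convergence of the energy
  alone does not determine the limit function. In dimension at least 3, the Sobolev inequality
  shows that a sequence of test functions which is Cauchy in the Dirichlet norm converges in
  \<open>L\<^sup>p\<close> with \<open>p = 2 N / (N - 2)\<close>, in particular in \<open>L\<^sup>1\<close> on every compact set; the second
  condition on \<open>\<phi>\<close> says that \<open>u\<close> is this limit.
\<close>

definition D12 :: "('a::euclidean_space \<Rightarrow> real) set" where
  "D12 = {u. (\<exists>g. has_weak_gradient u g) \<and>
     (\<exists>\<phi>. (\<forall>k::nat. test_function (\<phi> k)) \<and>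
        (\<forall>K. compact K \<longrightarrow>
           (\<lambda>k. \<integral>\<^sup>+x\<in>K. ennreal \<bar>\<phi> k x - u x\<bar> \<partial>lebesgue) \<longlonglongrightarrow> 0) \<and>
        (\<lambda>k. dirichlet_energy (\<lambda>x. \<phi> k x - u x)) \<longlonglongrightarrow> 0)}"

definition L2 :: "('a::euclidean_space \<Rightarrow> real) set" where
  "L2 = {f \<in> borel_measurable lebesgue. integrable lebesgue (\<lambda>x. (f x)\<^sup>2)}"

definition circle :: "real \<Rightarrow> ((real^2) \<times> (real^'m)) set" where
  "circle r = {(x, 0) | x. norm x = r}"

definition circle_param :: "real \<Rightarrow> real \<Rightarrow> (real^2) \<times> (real^'m)" where
  "circle_param r s = (vector [r * cos (s / r), r * sin (s / r)], 0)"

text \<open>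
  Arc length is the image of Lebesgue measure under the unit-speed parametrisation
  of the circle, which runs through it exactly once on \<open>[0, 2 \<pi> r)\<close>.
\<close>

definition arc_length :: "real \<Rightarrow> ((real^2) \<times> (real^'m)) measure" where
  "arc_length r = distr (restrict_space lborel {0..<2 * pi * r}) borel (circle_param r)"

lemma bij_betw_circle_param:
  assumes "r > 0"
  shows "bij_betw (circle_param r) {0..<2 * pi * r} (circle r)"
proof -
  have inj: "s = t" if s: "0 \<le> s" "s < 2 * pi * r" and t: "0 \<le> t" "t < 2 * pi * r"
    and eq: "cos (s / r) = cos (t / r)" "sin (s / r) = sin (t / r)" for s t
  proof -
    from eq have "sin (s / r) = sin (t / r) \<and> cos (s / r) = cos (t / r)" by simp
    then obtain n :: int where n: "s / r = t / r + 2 * pi * n"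
      using sin_cos_eq_iff by blast
    have "\<bar>s / r - t / r\<bar> < 2 * pi"
      using s t assms by (simp add: abs_if field_simps)
    then have "\<bar>2 * pi * n\<bar> < 2 * pi" using n by simp
    then have "\<bar>real_of_int n\<bar> < 1" by (simp add: abs_mult)
    then have "n = 0" by linarith
    with n assms show ?thesis by simp
  qed
  have surj: "\<exists>s\<in>{0..<2 * pi * r}. x = vector [r * cos (s / r), r * sin (s / r)]"
    if x: "norm x = r" for x :: "real^2"
  proof -
    have "(x $ 1)\<^sup>2 + (x $ 2)\<^sup>2 = r\<^sup>2"
      using x by (auto simp: norm_eq_sqrt_inner inner_vec_def sum_2 power2_eq_square)
    then have "(x $ 1 / r)\<^sup>2 + (x $ 2 / r)\<^sup>2 = 1"
      using assms by (simp add: field_simps)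
    then obtain t where t: "0 \<le> t" "t < 2 * pi" "x $ 1 / r = cos t" "x $ 2 / r = sin t"
      using sincos_total_2pi by metis
    then show ?thesis
      using assms by (intro bexI[of _ "t * r"]) (auto simp: vec_eq_iff forall_2 field_simps)
  qed
  have norm: "norm (vector [r * cos t, r * sin t] :: real^2) = r" for t
    using assms by (simp add: norm_eq_sqrt_inner inner_vec_def sum_2 flip: power2_eq_square)
      (simp add: power_mult_distrib flip: distrib_left)
  show ?thesis
    unfolding bij_betw_def
  proof
    show "inj_on (circle_param r) {0..<2 * pi * r}"
    proof (rule inj_onI)
      fix s t assume s: "s \<in> {0..<2 * pi * r}" and t: "t \<in> {0..<2 * pi * r}"
        and eq: "(circle_param r s :: (real^2) \<times> (real^'m)) = circle_param r t"
      have *: "cos (s / r) = cos (t / r)" "sin (s / r) = sin (t / r)"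
        using eq assms by (simp_all add: circle_param_def vec_eq_iff forall_2)
      show "s = t" by (rule inj[OF _ _ _ _ *]) (use s t in simp_all)
    qed
    show "circle_param r ` {0..<2 * pi * r} = circle r"
      unfolding circle_param_def circle_def
    proof (intro equalityI subsetI)
      fix p :: "(real^2) \<times> (real^'m)" assume "p \<in> {(x, 0) | x. norm x = r}"
      then obtain x where p: "p = (x, 0)" and x: "norm x = r" by auto
      from surj[OF x] obtain s
        where "s \<in> {0..<2 * pi * r}" "x = vector [r * cos (s / r), r * sin (s / r)]" ..
      then show "p \<in> (\<lambda>s. (vector [r * cos (s / r), r * sin (s / r)], 0)) ` {0..<2 * pi * r}"
        using p by (intro image_eqI[of _ _ s]) simp_all
    qed (use norm in auto)
  qed
qed

lemma circle_param_unit_speed: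
  assumes "r > 0"
  shows "norm (vector_derivative (circle_param r :: real \<Rightarrow> (real^2) \<times> (real^'m)) (at s)) = 1"
proof -
  have *: "(circle_param r :: real \<Rightarrow> (real^2) \<times> (real^'m)) =
      (\<lambda>s. ((r * cos (s / r)) *\<^sub>R axis 1 1 + (r * sin (s / r)) *\<^sub>R axis 2 1, 0))"
    by (auto simp: circle_param_def vec_eq_iff forall_2 axis_def fun_eq_iff)
  have "(circle_param r has_vector_derivative
      (((- sin (s / r)) *\<^sub>R axis 1 1 + cos (s / r) *\<^sub>R axis 2 1, 0) :: (real^2) \<times> (real^'m))) (at s)"
    unfolding * using assms by (auto intro!: derivative_eq_intros has_vector_derivative_Pair)
  then have D: "vector_derivative (circle_param r) (at s) =
      (((- sin (s / r)) *\<^sub>R axis 1 1 + cos (s / r) *\<^sub>R axis 2 1, 0) :: (real^2) \<times> (real^'m))"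
    by (rule vector_derivative_at)
  show ?thesis
    unfolding D
    by (simp add: norm_Pair norm_eq_sqrt_inner inner_vec_def sum_2 axis_def
        flip: power2_eq_square)
qed

text \<open>
  On the circle itself, a null set, the integral diverges and \<open>circle_potential\<close> takes the
  conventional value 0; everywhere else the integrand is bounded and continuous on the circle.
\<close>

definition circle_potential :: "real \<Rightarrow> (real^2) \<times> (real^'m) \<Rightarrow> real" where
  "circle_potential r y = (LINT x:circle r|arc_length r. 1 / (norm (x - y))\<^sup>2)"

end

theory Submission
  imports Defs
begin

text \<open>
  The inequality is the classical Hardy inequality
  \<open>c\<^sup>2 \<integral> u\<^sup>2 / |y - p|\<^sup>2 \<le> \<integral> |\<nabla>u|\<^sup>2\<close> with \<open>c = (N - 2) / 2\<close>, averaged over all points \<open>p\<close> of the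
  circle: by Tonelli the average of the left-hand sides is the integral against the circle
  potential. What makes the averaged inequality strict and still optimal is the following.

  Hardy's inequality is used in a form with remainder (\<open>hardy_with_remainder\<close>):
  \<open>\<integral> |\<nabla>u + c u (y - p) / |y - p|\<^sup>2|\<^sup>2 + c\<^sup>2 u\<^sup>2 / |y - p|\<^sup>2 \<le> \<integral> |\<nabla>u|\<^sup>2\<close>. For a test function it
  comes from integrating the divergence of \<open>\<phi>\<^sup>2 (y - p) / (|y - p|\<^sup>2 + \<epsilon>)\<close>, which is zero
  (\<open>hardy_test_function_regularised\<close>). Fatou's lemma then removes \<open>\<epsilon>\<close> and passes to the closure at the
  same time.

  If the averaged inequality is an equality for \<open>u\<close>, then Hardy's inequality is an equality at almost
  every point of the circle, in particular at two different points \<open>p\<close> and \<open>q\<close>. Both remainders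
  vanish, so \<open>u (y - p) / |y - p|\<^sup>2 = u (y - q) / |y - q|\<^sup>2\<close> almost everywhere. As inversion in
  the unit sphere is injective, \<open>u = 0\<close> (\<open>hardy_equality_at_two_points_imp_zero\<close>).

  For optimality, Jensen's inequality bounds the mean of \<open>1 / |x - y|\<^sup>2\<close> over the circle from below by
  \<open>1 / (r\<^sup>2 + |y|\<^sup>2)\<close>, since the mean of \<open>|x - y|\<^sup>2\<close> is \<open>r\<^sup>2 + |y|\<^sup>2\<close>
  (\<open>circle_potential_lower_bound\<close>). The functions \<open>U = (r\<^sup>2 + |y|\<^sup>2)\<^sup>-\<^sup>b\<^sup>/\<^sup>2\<close> satisfy
  \<open>|\<nabla>U|\<^sup>2 \<le> b\<^sup>2 U\<^sup>2 / (r\<^sup>2 + |y|\<^sup>2)\<close>, and the right-hand side is integrable exactly for \<open>b > c\<close>. Letting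
  \<open>b\<close> decrease to \<open>c\<close> and cutting off smoothly gives test functions whose quotient tends to \<open>c\<^sup>2\<close>
  (\<open>hardy_almost_optimal_test_function\<close>).

  Weak gradients are determined only up to null sets, so the energy of a function can be
  computed from any of its weak gradients only after their uniqueness is known. This is the fundamental lemma
  of the calculus of variations (\<open>AE_zero_if_test_integrals_zero\<close>), proved with products of one-dimensional
  smooth bumps that approximate the indicators of boxes.
\<close>

section \<open>Calculus of \<open>C\<^sup>k\<close> functions\<close>

lemma Ck_const: "Ck k (\<lambda>x. c)"
  by (induction k arbitrary: c) auto

lemma Ck_Suc_D: "Ck (Suc k) f \<Longrightarrow> Ck k f"
proof (induction k arbitrary: f)
  case 0
  then show ?case by (auto intro: differentiable_imp_continuous_on)
next
  case (Suc k)
  from Suc.prems have *: "f differentiable_on UNIV \<and>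
      (\<forall>b\<in>Basis. Ck (Suc k) (\<lambda>x. frechet_derivative f (at x) b))"
    by (rule Ck.simps(2)[THEN iffD1])
  show ?case
    by (rule Ck.simps(2)[THEN iffD2]) (use * Suc.IH in blast)
qed

lemma Ck_SucI:
  assumes "\<And>x. (f has_derivative (\<lambda>h. f' h x)) (at x)"
    and "\<And>b. b \<in> Basis \<Longrightarrow> Ck k (f' b)"
  shows "Ck (Suc k) f"
proof -
  have "frechet_derivative f (at x) = (\<lambda>h. f' h x)" for x
    using frechet_derivative_at[OF assms(1)] by simp
  moreover have "f differentiable_on UNIV"
    using assms(1) by (auto simp: differentiable_on_def differentiable_def)
  ultimately show ?thesis using assms(2) by simp
qed

lemma Ck_Suc_has_derivative:
  "Ck (Suc k) f \<Longrightarrow> (f has_derivative frechet_derivative f (at x)) (at x)"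
  by (auto simp: differentiable_on_def frechet_derivative_works)

lemma Ck_Suc_partial: "Ck (Suc k) f \<Longrightarrow> b \<in> Basis \<Longrightarrow> Ck k (\<lambda>x. frechet_derivative f (at x) b)"
  by simp

lemma Ck_continuous: "Ck k f \<Longrightarrow> continuous_on UNIV f"
  by (cases k) (auto intro: differentiable_imp_continuous_on)

lemma Ck_add: "Ck k f \<Longrightarrow> Ck k g \<Longrightarrow> Ck k (\<lambda>x. f x + g x)"
proof (induction k arbitrary: f g)
  case 0
  then show ?case by (simp add: continuous_on_add)
next
  case (Suc k)
  show ?case
  proof (rule Ck_SucI)
    show "((\<lambda>x. f x + g x) has_derivative
        (\<lambda>h. frechet_derivative f (at x) h + frechet_derivative g (at x) h)) (at x)" for x
      by (rule has_derivative_add[OF Suc.prems[THEN Ck_Suc_has_derivative]])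
    show "Ck k (\<lambda>x. frechet_derivative f (at x) b + frechet_derivative g (at x) b)" if "b \<in> Basis" for b
      by (rule Suc.IH[OF Suc.prems(1)[THEN Ck_Suc_partial, OF that] Suc.prems(2)[THEN Ck_Suc_partial, OF that]])
  qed
qed

lemma Ck_mult: "Ck k f \<Longrightarrow> Ck k g \<Longrightarrow> Ck k (\<lambda>x. f x * g x)"
proof (induction k arbitrary: f g)
  case 0
  then show ?case by (simp add: continuous_on_mult)
next
  case (Suc k)
  show ?case
  proof (rule Ck_SucI)
    show "((\<lambda>x. f x * g x) has_derivative
        (\<lambda>h. f x * frechet_derivative g (at x) h + frechet_derivative f (at x) h * g x)) (at x)" for x
      by (rule has_derivative_mult[OF Suc.prems[THEN Ck_Suc_has_derivative]])
    show "Ck k (\<lambda>x. f x * frechet_derivative g (at x) b + frechet_derivative f (at x) b * g x)"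
      if "b \<in> Basis" for b
      by (rule Ck_add[OF
          Suc.IH[OF Ck_Suc_D[OF Suc.prems(1)] Ck_Suc_partial[OF Suc.prems(2) that]]
          Suc.IH[OF Ck_Suc_partial[OF Suc.prems(1) that] Ck_Suc_D[OF Suc.prems(2)]]])
  qed
qed

lemma Ck_inner: "Ck k (\<lambda>x. x \<bullet> a)"
proof (cases k)
  case 0
  then show ?thesis by (simp add: continuous_on_inner)
next
  case (Suc n)
  have "Ck (Suc n) (\<lambda>x. x \<bullet> a)"
    by (rule Ck_SucI[where f' = "\<lambda>h x. h \<bullet> a"])
       (rule bounded_linear_imp_has_derivative[OF bounded_linear_inner_left] Ck_const)+
  with Suc show ?thesis by simp
qed

lemma Ck_diff: "Ck k f \<Longrightarrow> Ck k g \<Longrightarrow> Ck k (\<lambda>x. f x - g x)"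
  using Ck_add[of k f "\<lambda>x. -1 * g x"] Ck_mult[OF Ck_const[of k "-1"], of g] by simp

lemma Ck_sum: "(\<And>i. i \<in> I \<Longrightarrow> Ck k (f i)) \<Longrightarrow> Ck k (\<lambda>x. \<Sum>i\<in>I. f i x)"
  by (induction I rule: infinite_finite_induct) (auto intro: Ck_const Ck_add)

lemma Ck_prod: "(\<And>i. i \<in> I \<Longrightarrow> Ck k (f i)) \<Longrightarrow> Ck k (\<lambda>x. \<Prod>i\<in>I. f i x)"
  by (induction I rule: infinite_finite_induct) (auto intro: Ck_const Ck_mult)

lemma Ck_inner_diff_self: "Ck k (\<lambda>x. (x - p) \<bullet> (x - p))"
proof -
  have "Ck k (\<lambda>x. \<Sum>b\<in>Basis. (x \<bullet> b - p \<bullet> b) * (x \<bullet> b - p \<bullet> b))"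
    by (intro Ck_sum Ck_mult Ck_diff Ck_inner Ck_const)
  moreover have "(x - p) \<bullet> (x - p) = (\<Sum>b\<in>Basis. (x \<bullet> b - p \<bullet> b) * (x \<bullet> b - p \<bullet> b))" for x
    by (subst euclidean_inner) (simp add: inner_diff_left)
  ultimately show ?thesis by simp
qed

text \<open>
  A family of real functions that is closed under differentiation consists of smooth functions. The
  family is kept in the statement because the induction on \<open>k\<close> moves from a function to its
  derivative; this covers real powers and smooth bumps alike.
\<close>

lemma Ck_compose:
  assumes "\<And>h. h \<in> S \<Longrightarrow> \<exists>h'\<in>S. \<forall>t\<in>T. (h has_real_derivative h' t) (at t)"
    and "\<And>x. f x \<in> T" and "Ck k f" and "h \<in> S"
  shows "Ck k (\<lambda>x. h (f x))"
  using assms(3,4)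
proof (induction k arbitrary: h)
  case 0
  obtain h' where "h' \<in> S" "\<forall>t\<in>T. (h has_real_derivative h' t) (at t)"
    using assms(1) 0 by blast
  then have "continuous_on T h"
    by (meson DERIV_isCont continuous_at_imp_continuous_on)
  then show ?case
    unfolding Ck.simps using 0 assms(2) by (intro continuous_on_compose2[OF \<open>continuous_on T h\<close>]) auto
next
  case (Suc k)
  obtain h' where h': "h' \<in> S" "\<And>t. t \<in> T \<Longrightarrow> (h has_real_derivative h' t) (at t)"
    using assms(1) Suc by blast
  show ?case
  proof (rule Ck_SucI)
    show "((\<lambda>x. h (f x)) has_derivative (\<lambda>v. h' (f x) * frechet_derivative f (at x) v)) (at x)" for x
      using h'(2)[OF assms(2)] Ck_Suc_has_derivative[OF Suc.prems(1), of x]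
      unfolding has_field_derivative_def by (rule has_derivative_compose[rotated])
    show "Ck k (\<lambda>x. h' (f x) * frechet_derivative f (at x) b)" if "b \<in> Basis" for b
      by (rule Ck_mult[OF Suc.IH[OF Ck_Suc_D[OF Suc.prems(1)] h'(1)]
          Ck_Suc_partial[OF Suc.prems(1) that]])
  qed
qed

lemma Ck_powr:
  assumes "\<And>x. f x > 0" "Ck k f"
  shows "Ck k (\<lambda>x. f x powr p)"
proof (rule Ck_compose[where S = "{\<lambda>t. c * t powr q | c q. True}" and T = "{0<..}"
      and h = "\<lambda>t. t powr p" and f = f])
  fix h :: "real \<Rightarrow> real" assume "h \<in> {\<lambda>t. c * t powr q | c q. True}"
  then obtain c q where h: "h = (\<lambda>t. c * t powr q)" by auto
  have "\<forall>t\<in>{0<..}. (h has_real_derivative (c * q) * t powr (q - 1)) (at t)"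
    unfolding h by (auto intro!: DERIV_cong[OF DERIV_cmult[OF has_real_derivative_powr]])
  then show "\<exists>h'\<in>{\<lambda>t. c * t powr q | c q. True}. \<forall>t\<in>{0<..}. (h has_real_derivative h' t) (at t)"
    by (intro bexI[of _ "\<lambda>t. (c * q) * t powr (q - 1)"]) auto
next
  show "(\<lambda>t. t powr p) \<in> {\<lambda>t. c * t powr q | c q. True}"
    by (rule CollectI, rule exI[of _ 1], rule exI[of _ p]) simp
qed (use assms in auto)

text \<open>
  The derivatives of \<open>exp (- 1 / t)\<close> are polynomials in \<open>1 / t\<close> times the same exponential. With the
  polynomial as a parameter the family is closed under differentiation; the standard smooth
  function that vanishes exactly on the nonpositive reals is \<open>exp_bump 1\<close>.
\<close>

definition exp_bump :: "real poly \<Rightarrow> real \<Rightarrow> real" where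
  "exp_bump p t = (if t > 0 then poly p (1 / t) * exp (- 1 / t) else 0)"

lemma poly_times_exp_minus_tendsto_0:
  fixes p :: "real poly"
  shows "((\<lambda>s. poly p s * exp (- s)) \<longlongrightarrow> 0) at_top"
proof -
  have "((\<lambda>s. \<Sum>i\<le>degree p. coeff p i * (s ^ i / exp s)) \<longlongrightarrow> (\<Sum>i\<le>degree p. coeff p i * 0)) at_top"
    by (intro tendsto_intros tendsto_power_div_exp_0)
  then show ?thesis
    by (simp add: poly_altdef sum_distrib_right exp_minus divide_inverse mult.assoc)
qed

lemma exp_bump_tendsto_0: "(exp_bump p \<longlongrightarrow> 0) (at 0)"
proof -
  have "(exp_bump p \<longlongrightarrow> 0) (at_right 0)"
  proof (rule Lim_transform_eventually)
    show "((\<lambda>t. poly p (inverse t) * exp (- inverse t)) \<longlongrightarrow> 0) (at_right 0)"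
      by (rule filterlim_compose[OF poly_times_exp_minus_tendsto_0 filterlim_inverse_at_top_right])
    show "\<forall>\<^sub>F t in at_right 0. poly p (inverse t) * exp (- inverse t) = exp_bump p t"
      by (auto simp: eventually_at_right_field exp_bump_def inverse_eq_divide intro!: exI[of _ 1])
  qed
  moreover have "(exp_bump p \<longlongrightarrow> 0) (at_left 0)"
    by (rule Lim_transform_eventually[OF tendsto_const])
       (auto simp: eventually_at_left_field exp_bump_def intro!: exI[of _ "-1"])
  ultimately show ?thesis by (simp add: filterlim_split_at)
qed

lemma exp_bump_has_derivative:
  "(exp_bump p has_real_derivative exp_bump ([:0, 0, 1:] * (p - pderiv p)) t) (at t)"
proof -
  consider "t > 0" | "t < 0" | "t = 0" by linarith
  then show ?thesis
  proof cases
    case 1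
    have "((\<lambda>t. poly p (1 / t) * exp (- 1 / t)) has_real_derivative
        exp_bump ([:0, 0, 1:] * (p - pderiv p)) t) (at t)"
      using 1 by (auto intro!: derivative_eq_intros
          DERIV_chain2[OF poly_DERIV, where g = "\<lambda>t. 1 / t"] simp: exp_bump_def field_simps power2_eq_square)
    then show ?thesis
      by (rule DERIV_cong_ev[OF refl _ refl, THEN iffD1, rotated])
         (use 1 in \<open>auto simp: exp_bump_def eventually_nhds intro!: exI[of _ "{0<..}"]\<close>)
  next
    case 2
    have "((\<lambda>t. 0) has_real_derivative exp_bump ([:0, 0, 1:] * (p - pderiv p)) t) (at t)"
      using 2 by (simp add: exp_bump_def)
    then show ?thesis
      by (rule DERIV_cong_ev[OF refl _ refl, THEN iffD1, rotated])
         (use 2 in \<open>auto simp: exp_bump_def eventually_nhds intro!: exI[of _ "{..<0}"]\<close>)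
  next
    case 3
    \<comment> \<open>The difference quotient at 0 is again a function of the family, with the polynomial multiplied by the variable.\<close>
    have "(exp_bump ([:0, 1:] * p) \<longlongrightarrow> 0) (at 0)" by (rule exp_bump_tendsto_0)
    then have "((\<lambda>h. (exp_bump p (0 + h) - exp_bump p 0) / h) \<longlongrightarrow> 0) (at 0)"
      by (rule Lim_transform_eventually) (auto simp: exp_bump_def eventually_at intro!: exI[of _ 1])
    with 3 show ?thesis by (simp add: DERIV_def exp_bump_def)
  qed
qed

lemma Ck_exp_bump: "Ck k f \<Longrightarrow> Ck k (\<lambda>x. exp_bump p (f x))"
proof (rule Ck_compose[where S = "range exp_bump" and T = UNIV and h = "exp_bump p" and f = f])
  show "\<exists>h'\<in>range exp_bump. \<forall>t\<in>UNIV. (h has_real_derivative h' t) (at t)"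
    if "h \<in> range exp_bump" for h
    using that exp_bump_has_derivative by blast
qed simp_all

section \<open>Gradients and integration by parts\<close>

lemma test_function_iff: "test_function \<phi> \<longleftrightarrow> (\<forall>k. Ck k \<phi>) \<and> bounded {x. \<phi> x \<noteq> 0}"
  by (simp add: test_function_def)

definition grad :: "('a::euclidean_space \<Rightarrow> real) \<Rightarrow> 'a \<Rightarrow> 'a" where
  "grad f x = (\<Sum>b\<in>Basis. frechet_derivative f (at x) b *\<^sub>R b)"

lemma grad_inner_Basis: "b \<in> Basis \<Longrightarrow> grad f x \<bullet> b = frechet_derivative f (at x) b"
  by (simp add: grad_def inner_sum_left_Basis)

lemma frechet_derivative_eq_grad:
  assumes "f differentiable (at x)"
  shows "frechet_derivative f (at x) h = grad f x \<bullet> h"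
proof -
  have lin: "linear (frechet_derivative f (at x))"
    using assms by (rule linear_frechet_derivative)
  have "frechet_derivative f (at x) h = frechet_derivative f (at x) (\<Sum>b\<in>Basis. (h \<bullet> b) *\<^sub>R b)"
    by (simp add: euclidean_representation)
  also have "\<dots> = (\<Sum>b\<in>Basis. (h \<bullet> b) * frechet_derivative f (at x) b)"
    by (simp add: linear_sum[OF lin] linear_scale[OF lin])
  also have "\<dots> = grad f x \<bullet> h"
    by (simp add: grad_def inner_sum_left inner_commute[of h] mult.commute)
  finally show ?thesis .
qed

lemma Ck_has_derivative_grad:
  assumes "Ck (Suc k) f"
  shows "(f has_derivative (\<lambda>h. grad f x \<bullet> h)) (at x)"
  using Ck_Suc_has_derivative[OF assms, of x] frechet_derivative_eq_grad[of f x]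
  by (metis (no_types, lifting) differentiable_def ext)

lemma grad_eqI:
  assumes "(f has_derivative (\<lambda>h. v \<bullet> h)) (at x)"
  shows "grad f x = v"
proof -
  have "frechet_derivative f (at x) = (\<lambda>h. v \<bullet> h)"
    using frechet_derivative_at[OF assms] by simp
  then show ?thesis by (simp add: grad_def euclidean_representation)
qed

lemma continuous_grad:
  assumes "Ck (Suc k) f"
  shows "continuous_on UNIV (grad f)"
  unfolding grad_def
  by (intro continuous_on_sum continuous_on_scaleR continuous_on_const
        Ck_continuous[OF Ck_Suc_partial[OF assms]])

lemma bounded_support_frechet_derivative:
  fixes f :: "'a::euclidean_space \<Rightarrow> real"
  assumes "bounded {x. f x \<noteq> 0}"
  shows "bounded {x. \<exists>b. frechet_derivative f (at x) b \<noteq> 0}"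
proof (rule bounded_subset)
  show "bounded (closure {x. f x \<noteq> 0})" using assms by (rule bounded_closure)
  show "{x. \<exists>b. frechet_derivative f (at x) b \<noteq> 0} \<subseteq> closure {x. f x \<noteq> 0}"
  proof safe
    fix x b assume nz: "frechet_derivative f (at x) b \<noteq> 0"
    show "x \<in> closure {x. f x \<noteq> 0}"
    proof (rule ccontr)
      assume x: "x \<notin> closure {x. f x \<noteq> 0}"
      have "((\<lambda>_. 0) has_derivative (\<lambda>_. 0)) (at x)" by simp
      then have "(f has_derivative (\<lambda>_. 0)) (at x)"
        by (rule has_derivative_transform_within_open[where s = "- closure {x. f x \<noteq> 0}"])
           (use x closure_subset[of "{x. f x \<noteq> 0}"] in auto)
      then have "frechet_derivative f (at x) = (\<lambda>_. 0)"
        using frechet_derivative_at by metis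
      with nz show False by simp
    qed
  qed
qed

lemma bounded_support_grad:
  fixes f :: "'a::euclidean_space \<Rightarrow> real"
  assumes "bounded {x. f x \<noteq> 0}"
  shows "bounded {x. grad f x \<noteq> 0}"
  by (rule bounded_subset[OF bounded_support_frechet_derivative[OF assms]])
     (auto simp: grad_def intro: sum.neutral)

lemma continuous_bounded_support:
  fixes f :: "'a::euclidean_space \<Rightarrow> 'b::euclidean_space"
  assumes "continuous_on UNIV f" "bounded {x. f x \<noteq> 0}"
  shows integrable_bounded_support: "integrable lborel f"
    and bounded_bounded_support: "\<exists>M\<ge>0. \<forall>x. norm (f x) \<le> M"
proof -
  let ?K = "closure {x. f x \<noteq> 0}"
  have K: "compact ?K" using assms(2) by simp
  have f: "f = (\<lambda>x. indicator ?K x *\<^sub>R f x)"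
    using closure_subset[of "{x. f x \<noteq> 0}"] by (fastforce simp: indicator_def)
  show "integrable lborel f"
    by (subst f, rule borel_integrable_compact[OF K])
       (use assms(1) continuous_on_subset in blast)
  have "bounded (f ` ?K)"
    by (rule compact_imp_bounded, rule compact_continuous_image[OF _ K])
       (use assms(1) continuous_on_subset in blast)
  then obtain M where "\<forall>y\<in>f ` ?K. norm y \<le> M" unfolding bounded_iff by blast
  then have "\<forall>x. norm (f x) \<le> max 0 M"
    using closure_subset[of "{x. f x \<noteq> 0}"] by (force simp: le_max_iff_disj)
  then show "\<exists>M\<ge>0. \<forall>x. norm (f x) \<le> M" by (intro exI[of _ "max 0 M"]) auto
qed

lemma lborel_integral_translate:
  fixes f :: "'a::euclidean_space \<Rightarrow> 'b::{banach, second_countable_topology}"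
  assumes [measurable]: "f \<in> borel_measurable borel"
  shows "(LINT x|lborel. f (a + x)) = (LINT x|lborel. f x)"
proof -
  have "(LINT x|lborel. f x) = (LINT x|distr lborel borel ((+) a). f x)"
    by (simp add: lborel_distr_plus)
  also have "\<dots> = (LINT x|lborel. f (a + x))"
    by (subst integral_distr) auto
  finally show ?thesis by simp
qed

text \<open>
  By translation invariance every difference quotient of \<open>f\<close> in direction \<open>e\<close> has integral zero. By the
  mean value theorem the difference quotients with step at most 1 are bounded by the maximum of the directional
  derivative, and they vanish outside one ball, so dominated convergence gives the claim.
\<close>

lemma integral_partial_derivative_eq_0:
  fixes f :: "'a::euclidean_space \<Rightarrow> real"
  assumes der: "\<And>x. (f has_derivative f' x) (at x)"
    and cont: "continuous_on UNIV (\<lambda>x. f' x e)"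
    and supp: "bounded {x. f x \<noteq> 0}"
  shows "integrable lborel (\<lambda>x. f' x e)" "(LINT x|lborel. f' x e) = 0"
proof -
  have fc: "continuous_on UNIV f"
    using der by (auto intro!: continuous_at_imp_continuous_on has_derivative_continuous)
  have [measurable]: "f \<in> borel_measurable borel"
    using fc by (rule borel_measurable_continuous_onI)
  have f': "f' x = frechet_derivative f (at x)" for x
    using der by (rule frechet_derivative_at)
  have supp': "bounded {x. f' x e \<noteq> 0}"
    by (rule bounded_subset[OF bounded_support_frechet_derivative[OF supp]]) (auto simp: f')
  show "integrable lborel (\<lambda>x. f' x e)"
    by (rule integrable_bounded_support[OF cont supp'])
  obtain M where M: "M \<ge> 0" "\<And>x. \<bar>f' x e\<bar> \<le> M"
    using bounded_bounded_support[OF cont supp'] by auto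
  obtain R where R: "\<And>x. f x \<noteq> 0 \<Longrightarrow> norm x \<le> R"
    using supp by (auto simp: bounded_iff)
  define h where "h n = 1 / real (Suc n)" for n
  have h: "0 < h n" "h n \<le> 1" for n by (auto simp: h_def)
  have h0: "h \<longlonglongrightarrow> 0" unfolding h_def by (rule LIMSEQ_Suc[OF lim_1_over_n])
  have h_at: "filterlim h (at 0) sequentially"
    unfolding filterlim_at using h(1) h0 by (simp add: less_imp_neq[symmetric])
  define D where "D n x = (f (x + h n *\<^sub>R e) - f x) / h n" for n x
  have [measurable]: "D n \<in> borel_measurable borel" for n
    unfolding D_def by measurable
  have line: "((\<lambda>t. f (x + t *\<^sub>R e)) has_real_derivative f' (x + t *\<^sub>R e) e) (at t)" for x t
  proof -
    have "((\<lambda>t. f (x + t *\<^sub>R e)) has_derivative (\<lambda>s. f' (x + t *\<^sub>R e) (s *\<^sub>R e))) (at t)"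
      by (rule has_derivative_compose[OF _ der]) (auto intro!: derivative_eq_intros)
    moreover have "f' (x + t *\<^sub>R e) (s *\<^sub>R e) = f' (x + t *\<^sub>R e) e * s" for s
      using linear_scale[OF has_derivative_linear[OF der]] by simp
    ultimately show ?thesis by (simp add: has_field_derivative_def)
  qed
  have int0: "(LINT x|lborel. D n x) = 0" for n
  proof -
    have i: "integrable lborel f" by (rule integrable_bounded_support[OF fc supp])
    have i': "integrable lborel (\<lambda>x. f (x + h n *\<^sub>R e))"
    proof (rule integrable_bounded_support)
      show "continuous_on UNIV (\<lambda>x. f (x + h n *\<^sub>R e))"
        by (rule continuous_on_compose2[OF fc]) (auto intro: continuous_intros)
      have "{x. f (x + h n *\<^sub>R e) \<noteq> 0} = (+) (- (h n *\<^sub>R e)) ` {x. f x \<noteq> 0}"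
        by (auto simp: image_iff algebra_simps intro!: bexI[of _ "_ + _"])
      then show "bounded {x. f (x + h n *\<^sub>R e) \<noteq> 0}"
        using bounded_translation[OF supp, of "- (h n *\<^sub>R e)"] by (simp only:)
    qed
    have "(LINT x|lborel. D n x) = ((LINT x|lborel. f (h n *\<^sub>R e + x)) - (LINT x|lborel. f x)) / h n"
      unfolding D_def using i i' by (simp add: add.commute)
    then show ?thesis by (simp add: lborel_integral_translate)
  qed
  have "(\<lambda>n. LINT x|lborel. D n x) \<longlonglongrightarrow> (LINT x|lborel. f' x e)"
  proof (rule integral_dominated_convergence[where w = "\<lambda>x. indicator (cball 0 (R + norm e)) x *\<^sub>R M"])
    show "(\<lambda>x. f' x e) \<in> borel_measurable lborel"
      using cont by (simp add: borel_measurable_continuous_onI)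
    show "D n \<in> borel_measurable lborel" for n by simp
    show "integrable lborel (\<lambda>x. indicator (cball 0 (R + norm e)) x *\<^sub>R M)"
      by (rule borel_integrable_compact) auto
    show "AE x in lborel. (\<lambda>n. D n x) \<longlonglongrightarrow> f' x e"
    proof (rule AE_I2)
      fix x
      have "((\<lambda>t. (f (x + t *\<^sub>R e) - f x) / t) \<longlongrightarrow> f' x e) (at 0)"
        using line[of x 0] by (simp add: DERIV_def)
      from filterlim_compose[OF this h_at] show "(\<lambda>n. D n x) \<longlonglongrightarrow> f' x e"
        unfolding D_def .
    qed
    show "AE x in lborel. norm (D n x) \<le> indicator (cball 0 (R + norm e)) x *\<^sub>R M" for n
    proof (rule AE_I2)
      fix x
      show "norm (D n x) \<le> indicator (cball 0 (R + norm e)) x *\<^sub>R M"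
      proof (cases "norm x \<le> R + norm e")
        case True
        obtain z where "f (x + h n *\<^sub>R e) - f (x + 0 *\<^sub>R e) = (h n - 0) * f' (x + z *\<^sub>R e) e"
          using MVT2[of 0 "h n" "\<lambda>t. f (x + t *\<^sub>R e)" "\<lambda>t. f' (x + t *\<^sub>R e) e"] line h by blast
        then have "D n x = f' (x + z *\<^sub>R e) e"
          using h(1)[of n] by (simp add: D_def)
        then show ?thesis using True M(2) by simp
      next
        case False
        have "norm (h n *\<^sub>R e) \<le> norm e" using h[of n] by (simp add: mult_left_le_one_le)
        then have "norm (x + h n *\<^sub>R e) > R"
          using False norm_diff_ineq[of x "h n *\<^sub>R e"] by linarith
        moreover have "norm x > R" using False norm_ge_zero[of e] by linarith
        ultimately have "f (x + h n *\<^sub>R e) = 0" "f x = 0" using R not_le by blast+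
        then show ?thesis using M(1) by (simp add: D_def indicator_def)
      qed
    qed
  qed
  then show "(LINT x|lborel. f' x e) = 0"
    unfolding int0 by (simp add: LIMSEQ_const_iff)
qed

lemma integration_by_parts:
  fixes f g :: "'a::euclidean_space \<Rightarrow> real"
  assumes f: "Ck (Suc k) f" and g: "Ck (Suc l) g" and supp: "bounded {x. f x \<noteq> 0}"
  shows "(LINT x|lborel. f x * (grad g x \<bullet> e)) = - (LINT x|lborel. (grad f x \<bullet> e) * g x)"
proof -
  note [continuous_intros] = Ck_continuous[OF f] Ck_continuous[OF g]
    continuous_grad[OF f] continuous_grad[OF g]
  have i1: "integrable lborel (\<lambda>x. f x * (grad g x \<bullet> e))"
    by (rule integrable_bounded_support) (auto intro!: continuous_intros bounded_subset[OF supp])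
  have i2: "integrable lborel (\<lambda>x. (grad f x \<bullet> e) * g x)"
    by (rule integrable_bounded_support)
       (auto intro!: continuous_intros bounded_subset[OF bounded_support_grad[OF supp]])
  have "(LINT x|lborel. f x * (grad g x \<bullet> e) + (grad f x \<bullet> e) * g x) = 0"
  proof (rule integral_partial_derivative_eq_0(2)
      [where f = "\<lambda>x. f x * g x" and f' = "\<lambda>x h. f x * (grad g x \<bullet> h) + (grad f x \<bullet> h) * g x"])
    show "((\<lambda>x. f x * g x) has_derivative (\<lambda>h. f x * (grad g x \<bullet> h) + (grad f x \<bullet> h) * g x)) (at x)" for x
      by (rule has_derivative_mult[OF Ck_has_derivative_grad[OF f] Ck_has_derivative_grad[OF g]])
  qed (auto intro!: continuous_intros bounded_subset[OF supp])
  then show ?thesis using i1 i2 by simp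
qed

text \<open>
  The function \<open>\<delta>\<close> is the divergence of the compactly supported field \<open>\<phi>\<^sup>2 X / q\<close>. Without the
  regularisation \<open>\<epsilon>\<close> the field would be singular at \<open>p\<close>.
\<close>

lemma integral_divergence_hardy_field:
  fixes \<phi> :: "'a::euclidean_space \<Rightarrow> real" and p :: 'a
  defines "X \<equiv> \<lambda>y. y - p"
  assumes \<phi>: "Ck (Suc k) \<phi>" and supp: "bounded {x. \<phi> x \<noteq> 0}" and \<epsilon>: "\<epsilon> > 0"
  defines "q \<equiv> \<lambda>y. X y \<bullet> X y + \<epsilon>"
  defines "\<delta> \<equiv> \<lambda>y. 2 * \<phi> y * (grad \<phi> y \<bullet> X y) / q y
      + (\<phi> y)\<^sup>2 * (DIM('a) / q y - 2 * (X y \<bullet> X y) / (q y)\<^sup>2)"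
  shows "integrable lborel \<delta>" "(LINT y|lborel. \<delta> y) = 0"
proof -
  note [continuous_intros] = Ck_continuous[OF \<phi>] continuous_grad[OF \<phi>]
  have q: "q y > 0" for y using \<epsilon> by (simp add: q_def add_nonneg_pos)
  then have q0[simp]: "q y \<noteq> 0" for y by (metis less_irrefl)
  have Xc[continuous_intros]: "continuous_on UNIV X" unfolding X_def by (intro continuous_intros)
  have qc[continuous_intros]: "continuous_on UNIV q" unfolding q_def by (intro continuous_intros)
  \<comment> \<open>The directional derivative in direction \<open>h\<close> of the component of the field along \<open>b\<close>.\<close>
  define \<delta>' where "\<delta>' b y h = 2 * \<phi> y * (grad \<phi> y \<bullet> h) * (X y \<bullet> b) / q y
      + (\<phi> y)\<^sup>2 * ((h \<bullet> b) / q y - 2 * (X y \<bullet> h) * (X y \<bullet> b) / (q y)\<^sup>2)" for b y h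
  have der: "((\<lambda>y. (\<phi> y)\<^sup>2 * ((X y \<bullet> b) / q y)) has_derivative \<delta>' b y) (at y)" for b y
  proof -
    have X: "(X has_derivative (\<lambda>h. h)) (at y)"
      unfolding X_def by (auto intro!: derivative_eq_intros)
    have "((\<lambda>y. X y \<bullet> X y + \<epsilon>) has_derivative (\<lambda>h. (X y \<bullet> h + h \<bullet> X y) + 0)) (at y)"
      by (intro has_derivative_add has_derivative_const has_derivative_inner X)
    then have dq: "(q has_derivative (\<lambda>h. 2 * (X y \<bullet> h))) (at y)"
      unfolding q_def by (simp add: inner_commute)
    show ?thesis
      by (rule has_derivative_eq_rhs[OF has_derivative_mult[OF
            has_derivative_power[OF Ck_has_derivative_grad[OF \<phi>], where n = 2]
            has_derivative_divide[OF has_derivative_inner_left[OF X] dq]]])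
         (auto simp: \<delta>'_def fun_eq_iff field_simps power2_eq_square)
  qed
  have c': "continuous_on UNIV (\<lambda>y. \<delta>' b y b)" for b
    unfolding \<delta>'_def by (intro continuous_intros) auto
  have supp': "bounded {y. (\<phi> y)\<^sup>2 * ((X y \<bullet> b) / q y) \<noteq> 0}" for b
    by (rule bounded_subset[OF supp]) auto
  note D = integral_partial_derivative_eq_0[OF der c' supp']
  have eq: "\<delta> = (\<lambda>y. \<Sum>b\<in>Basis. \<delta>' b y b)"
  proof
    fix y
    have 1: "(\<Sum>b\<in>Basis. (grad \<phi> y \<bullet> b) * (X y \<bullet> b)) = grad \<phi> y \<bullet> X y"
      "(\<Sum>b\<in>Basis. (X y \<bullet> b) * (X y \<bullet> b)) = X y \<bullet> X y"
      by (rule euclidean_inner[symmetric])+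
    have "(\<Sum>b\<in>Basis. \<delta>' b y b) = 2 * \<phi> y / q y * (\<Sum>b\<in>Basis. (grad \<phi> y \<bullet> b) * (X y \<bullet> b))
        + (\<phi> y)\<^sup>2 * (DIM('a) / q y - 2 / (q y)\<^sup>2 * (\<Sum>b\<in>Basis. (X y \<bullet> b) * (X y \<bullet> b)))"
      by (simp add: \<delta>'_def sum.distrib sum_subtractf sum_distrib_left flip: sum_distrib_left)
         (simp add: sum_distrib_left sum_divide_distrib mult_ac)
    then show "\<delta> y = (\<Sum>b\<in>Basis. \<delta>' b y b)"
      unfolding 1 by (simp add: \<delta>_def)
  qed
  show "integrable lborel \<delta>" "(LINT y|lborel. \<delta> y) = 0"
    unfolding eq using D by simp_all
qed

section \<open>Hardy's inequality with remainder for test functions\<close>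

text \<open>
  Completing the square with the regularised field turns \<open>|\<nabla>\<phi>|\<^sup>2 + c \<delta>\<close>, where \<open>\<delta>\<close> is a divergence,
  into the remainder plus the potential term plus something nonnegative. The choice
  \<open>c = (N - 2) / 2\<close> maximises the factor \<open>c (N - 2) - c\<^sup>2\<close> left in front of the potential term.
\<close>

lemma hardy_test_function_regularised:
  fixes \<phi> :: "'a::euclidean_space \<Rightarrow> real" and p :: 'a
  assumes \<phi>: "Ck (Suc k) \<phi>" and supp: "bounded {x. \<phi> x \<noteq> 0}" and \<epsilon>: "\<epsilon> > 0"
    and c: "c = (real DIM('a) - 2) / 2" "c \<ge> 0"
  defines "q \<equiv> \<lambda>y. (norm (y - p))\<^sup>2 + \<epsilon>"
  shows "(\<integral>\<^sup>+y. ennreal ((norm (grad \<phi> y + (c * \<phi> y / q y) *\<^sub>R (y - p)))\<^sup>2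
            + c\<^sup>2 * (\<phi> y)\<^sup>2 / q y) \<partial>lborel)
          \<le> (\<integral>\<^sup>+y. ennreal ((norm (grad \<phi> y))\<^sup>2) \<partial>lborel)"
proof -
  define X where "X y = y - p" for y
  define \<delta> where "\<delta> y = 2 * \<phi> y * (grad \<phi> y \<bullet> X y) / q y
      + (\<phi> y)\<^sup>2 * (DIM('a) / q y - 2 * (X y \<bullet> X y) / (q y)\<^sup>2)" for y
  have q_eq: "q = (\<lambda>y. X y \<bullet> X y + \<epsilon>)" by (simp add: q_def X_def power2_norm_eq_inner)
  have \<delta>: "integrable lborel \<delta>" "(LINT y|lborel. \<delta> y) = 0"
    using integral_divergence_hardy_field[OF \<phi> supp \<epsilon>, of p]
    unfolding \<delta>_def q_eq X_def by auto
  have i: "integrable lborel (\<lambda>y. (norm (grad \<phi> y))\<^sup>2)"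
    by (rule integrable_bounded_support)
       (auto intro!: continuous_intros continuous_grad[OF \<phi>] bounded_support_grad[OF supp])
  have le: "(norm (grad \<phi> y + (c * \<phi> y / q y) *\<^sub>R (y - p)))\<^sup>2 + c\<^sup>2 * (\<phi> y)\<^sup>2 / q y
      \<le> (norm (grad \<phi> y))\<^sup>2 + c * \<delta> y" for y
  proof -
    define s where "s = X y \<bullet> X y"
    have qs: "q y = s + \<epsilon>" by (simp add: q_eq s_def)
    have s0: "s \<ge> 0" by (simp add: s_def)
    have q0: "q y > 0" using qs s0 \<epsilon> by simp
    have N: "real DIM('a) = 2 * c + 2" using c(1) by simp
    \<comment> \<open>The cross term of the square is the first term of \<open>c * \<delta> y\<close>; what is left over is compared below.\<close>
    have "(norm (grad \<phi> y + (c * \<phi> y / q y) *\<^sub>R X y))\<^sup>2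
        = (norm (grad \<phi> y))\<^sup>2 + c * (2 * \<phi> y * (grad \<phi> y \<bullet> X y) / q y) + c\<^sup>2 * (\<phi> y)\<^sup>2 * s / (q y)\<^sup>2"
      unfolding power2_norm_eq_inner
      by (simp add: inner_add_left inner_add_right inner_commute[of "X y" "grad \<phi> y"] s_def
          power2_eq_square add_divide_distrib algebra_simps)
    moreover have "c\<^sup>2 * (\<phi> y)\<^sup>2 * s / (q y)\<^sup>2 + c\<^sup>2 * (\<phi> y)\<^sup>2 / q y
        \<le> c * ((\<phi> y)\<^sup>2 * (DIM('a) / q y - 2 * s / (q y)\<^sup>2))"
    proof -
      \<comment> \<open>With \<open>N = 2 c + 2\<close> the terms combine to a multiple of \<open>q - s\<close>, which is \<open>\<epsilon>\<close>.\<close>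
      have "c * ((\<phi> y)\<^sup>2 * (DIM('a) / q y - 2 * s / (q y)\<^sup>2))
          - (c\<^sup>2 * (\<phi> y)\<^sup>2 * s / (q y)\<^sup>2 + c\<^sup>2 * (\<phi> y)\<^sup>2 / q y)
          = (c\<^sup>2 + 2 * c) * (\<phi> y)\<^sup>2 * (q y - s) / (q y)\<^sup>2"
        unfolding N using q0 by (simp add: field_simps power2_eq_square)
      also have "\<dots> \<ge> 0" using c(2) qs \<epsilon> by simp
      finally show ?thesis by simp
    qed
    ultimately show ?thesis
      by (simp add: \<delta>_def X_def[symmetric] s_def[symmetric] distrib_left)
  qed
  have nn: "0 \<le> (norm (grad \<phi> y))\<^sup>2 + c * \<delta> y" for y
    by (rule order_trans[OF _ le]) (simp add: q_def add_nonneg_nonneg \<epsilon> less_imp_le)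
  have "(\<integral>\<^sup>+y. ennreal ((norm (grad \<phi> y + (c * \<phi> y / q y) *\<^sub>R (y - p)))\<^sup>2
            + c\<^sup>2 * (\<phi> y)\<^sup>2 / q y) \<partial>lborel)
      \<le> (\<integral>\<^sup>+y. ennreal ((norm (grad \<phi> y))\<^sup>2 + c * \<delta> y) \<partial>lborel)"
    by (intro nn_integral_mono ennreal_leI le)
  also have "\<dots> = ennreal (LINT y|lborel. (norm (grad \<phi> y))\<^sup>2 + c * \<delta> y)"
    by (rule nn_integral_eq_integral) (use i \<delta> nn in auto)
  also have "\<dots> = ennreal (LINT y|lborel. (norm (grad \<phi> y))\<^sup>2)"
    using i \<delta> by simp
  also have "\<dots> = (\<integral>\<^sup>+y. ennreal ((norm (grad \<phi> y))\<^sup>2) \<partial>lborel)"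
    by (rule nn_integral_eq_integral[symmetric]) (use i in auto)
  finally show ?thesis .
qed

section \<open>Uniqueness of weak gradients\<close>

lemma locally_integrable_measurable:
  fixes f :: "'a::euclidean_space \<Rightarrow> 'b::euclidean_space"
  assumes "locally_integrable f"
  shows "f \<in> borel_measurable lebesgue"
proof (rule borel_measurable_LIMSEQ_metric)
  fix n :: nat
  have "set_integrable lebesgue (cball 0 (real n)) f"
    using assms by (simp add: locally_integrable_def)
  then show "(\<lambda>x. indicat_real (cball 0 (real n)) x *\<^sub>R f x) \<in> borel_measurable lebesgue"
    by (auto simp: set_integrable_def)
next
  fix x :: 'a
  obtain N :: nat where "norm x \<le> real N" using real_arch_simple by blast
  then have "\<forall>n\<ge>N. indicat_real (cball 0 (real n)) x *\<^sub>R f x = f x"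
    by (auto simp: indicator_def)
  then show "(\<lambda>n. indicat_real (cball 0 (real n)) x *\<^sub>R f x) \<longlonglongrightarrow> f x"
    by (intro tendsto_eventually) (auto simp: eventually_sequentially)
qed

lemma continuous_imp_locally_integrable:
  fixes f :: "'a::euclidean_space \<Rightarrow> 'b::euclidean_space"
  assumes "continuous_on UNIV f"
  shows "locally_integrable f"
  unfolding locally_integrable_def set_integrable_def
proof (intro allI impI)
  fix K :: "'a set" assume K: "compact K"
  have "integrable lborel (\<lambda>x. indicator K x *\<^sub>R f x)"
    by (rule borel_integrable_compact[OF K]) (use assms continuous_on_subset in blast)
  then show "integrable lebesgue (\<lambda>x. indicator K x *\<^sub>R f x)"
    using integrable_completion borel_measurable_integrable by blast
qed

lemma locally_integrable_diff:
  "locally_integrable f \<Longrightarrow> locally_integrable g \<Longrightarrow> locally_integrable (\<lambda>x. f x - g x)"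
  by (auto simp: locally_integrable_def)

lemma locally_integrable_inner:
  assumes "locally_integrable f"
  shows "locally_integrable (\<lambda>x. f x \<bullet> b)"
  unfolding locally_integrable_def set_integrable_def
proof (intro allI impI)
  fix K :: "'a set" assume "compact K"
  then have "integrable lebesgue (\<lambda>x. indicator K x *\<^sub>R f x)"
    using assms by (auto simp: locally_integrable_def set_integrable_def)
  then have "integrable lebesgue (\<lambda>x. (indicator K x *\<^sub>R f x) \<bullet> b)"
    by (rule integrable_inner_left)
  then show "integrable lebesgue (\<lambda>x. indicator K x *\<^sub>R (f x \<bullet> b))" by simp
qed

lemma locally_integrable_mult_integrable:
  fixes f \<psi> :: "'a::euclidean_space \<Rightarrow> real"
  assumes f: "locally_integrable f" and \<psi>: "continuous_on UNIV \<psi>" "bounded {x. \<psi> x \<noteq> 0}"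
  shows "integrable lebesgue (\<lambda>x. f x * \<psi> x)"
proof -
  obtain M where M: "M \<ge> 0" "\<And>x. \<bar>\<psi> x\<bar> \<le> M"
    using bounded_bounded_support[OF \<psi>] by auto
  let ?K = "closure {x. \<psi> x \<noteq> 0}"
  have [measurable]: "f \<in> borel_measurable lebesgue"
    using f by (rule locally_integrable_measurable)
  have [measurable]: "\<psi> \<in> borel_measurable lebesgue"
    using \<psi>(1) by (intro measurable_completion) (simp add: borel_measurable_continuous_onI)
  have "integrable lebesgue (\<lambda>x. M * (indicator ?K x *\<^sub>R f x))"
    using f \<psi>(2) by (auto simp: locally_integrable_def set_integrable_def)
  then show ?thesis
  proof (rule Bochner_Integration.integrable_bound)
    show "AE x in lebesgue. norm (f x * \<psi> x) \<le> norm (M * (indicator ?K x *\<^sub>R f x))"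
    proof (rule AE_I2)
      fix x
      show "norm (f x * \<psi> x) \<le> norm (M * (indicator ?K x *\<^sub>R f x))"
      proof (cases "\<psi> x = 0")
        case False
        then have "x \<in> ?K" using closure_subset[of "{x. \<psi> x \<noteq> 0}"] by blast
        then show ?thesis
          using M mult_left_mono[OF M(2)[of x] abs_ge_zero[of "f x"]] by (simp add: abs_mult mult.commute)
      qed simp
    qed
  qed measurable
qed

lemma exp_bump_one: "exp_bump 1 t = (if t > 0 then exp (- 1 / t) else 0)"
  by (simp add: exp_bump_def)

lemma exp_bump_one_bounds: "0 \<le> exp_bump 1 t" "exp_bump 1 t \<le> 1"
  by (auto simp: exp_bump_one)

lemma exp_bump_one_scaled_tendsto: "(\<lambda>n. exp_bump 1 (real (Suc n) * t)) \<longlonglongrightarrow> (if t > 0 then 1 else 0)"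
proof (cases "t > 0")
  case True
  have "(\<lambda>n. exp (- (1 / t) * (1 / real (Suc n)))) \<longlonglongrightarrow> exp (- (1 / t) * 0)"
    by (intro tendsto_intros LIMSEQ_Suc[OF lim_1_over_n])
  then show ?thesis using True by (simp add: exp_bump_one mult.commute)
next
  case False
  then have "\<not> 0 < real (Suc n) * t" for n by (simp add: zero_less_mult_iff)
  then show ?thesis using False by (simp add: exp_bump_one del: of_nat_Suc)
qed

text \<open>
  The product over all coordinates of smooth one-sided bumps in \<open>n (x\<^sub>i - a\<^sub>i)\<close> and \<open>n (b\<^sub>i - x\<^sub>i)\<close> vanishes
  exactly outside the box, and tends to 1 inside it because \<open>exp (- 1 / (n t))\<close> tends to 1
  for \<open>t > 0\<close>.
\<close>

lemma test_function_box_approximation: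
  fixes a b :: "'a::euclidean_space"
  obtains \<phi> :: "nat \<Rightarrow> 'a \<Rightarrow> real" where
    "\<And>n. test_function (\<phi> n)" "\<And>n x. \<bar>\<phi> n x\<bar> \<le> indicator (box a b) x"
    "\<And>x. (\<lambda>n. \<phi> n x) \<longlonglongrightarrow> indicator (box a b) x"
proof
  define e where "e n i x = exp_bump 1 (real (Suc n) * (x \<bullet> i - a \<bullet> i)) * exp_bump 1 (real (Suc n) * (b \<bullet> i - x \<bullet> i))"
    for n i x
  define \<phi> where "\<phi> n x = (\<Prod>i\<in>Basis. e n i x)" for n and x :: 'a
  have e01: "0 \<le> e n i x" "e n i x \<le> 1" for n i x
    by (auto simp: e_def exp_bump_one_bounds intro!: mult_nonneg_nonneg mult_le_one)
  have e0: "e n i x = 0" if "\<not> (a \<bullet> i < x \<bullet> i \<and> x \<bullet> i < b \<bullet> i)" for n i x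
    using that by (auto simp: e_def exp_bump_one zero_less_mult_iff)
  show bound: "\<bar>\<phi> n x\<bar> \<le> indicator (box a b) x" for n x
  proof (cases "x \<in> box a b")
    case True
    then show ?thesis by (simp add: \<phi>_def abs_prod e01 prod_le_1)
  next
    case False
    then obtain i where "i \<in> Basis" "\<not> (a \<bullet> i < x \<bullet> i \<and> x \<bullet> i < b \<bullet> i)" by (auto simp: mem_box)
    then have "\<phi> n x = 0" unfolding \<phi>_def using e0 by (intro prod_zero) auto
    then show ?thesis by simp
  qed
  show "test_function (\<phi> n)" for n
    unfolding test_function_iff
  proof (intro conjI allI)
    show "Ck k (\<phi> n)" for k
      unfolding \<phi>_def e_def
      by (intro Ck_prod Ck_mult Ck_exp_bump Ck_diff Ck_inner Ck_const)
    show "bounded {x. \<phi> n x \<noteq> 0}"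
    proof (rule bounded_subset[OF bounded_box[of a b]], safe)
      show "x \<in> box a b" if "\<phi> n x \<noteq> 0" for x
        using bound[of n x] that by (cases "x \<in> box a b") auto
    qed
  qed
  show "(\<lambda>n. \<phi> n x) \<longlonglongrightarrow> indicator (box a b) x" for x
  proof -
    have "(\<lambda>n. \<phi> n x) \<longlonglongrightarrow> (\<Prod>i\<in>Basis. (if x \<bullet> i - a \<bullet> i > 0 then 1 else 0) * (if b \<bullet> i - x \<bullet> i > 0 then 1 else 0))"
      unfolding \<phi>_def e_def by (intro tendsto_intros exp_bump_one_scaled_tendsto)
    also have "(\<Prod>i\<in>Basis. (if x \<bullet> i - a \<bullet> i > 0 then 1 else 0) * (if b \<bullet> i - x \<bullet> i > 0 then 1 else 0))
        = (indicator (box a b) x :: real)"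
      by (cases "x \<in> box a b") (auto simp: mem_box intro!: prod_zero)
    finally show ?thesis .
  qed
qed

text \<open>
  Boxes form a generator of the Borel sets that is stable under intersection, so the integral over every Borel set
  vanishes by a Dynkin argument. The whole space is not a box; its integral is needed for complements.
  Lebesgue measurable sets are not generated by boxes, hence the passage to a Borel representative \<open>F'\<close>.
\<close>

lemma AE_zero_if_box_integrals_zero:
  fixes F :: "'a::euclidean_space \<Rightarrow> real"
  assumes F: "integrable lebesgue F"
    and box: "\<And>a b. (LINT x|lebesgue. indicator (box a b) x * F x) = 0"
    and UNIV: "(LINT x|lebesgue. F x) = 0"
  shows "AE x in lebesgue. F x = 0"
proof -
  have "F \<in> borel_measurable lebesgue" using F by (rule borel_measurable_integrable)
  from completion_ex_borel_measurable_real[OF this]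
  obtain F' where F'm: "F' \<in> borel_measurable lborel" and ae: "AE x in lborel. F x = F' x"
    by blast
  have [measurable]: "F' \<in> borel_measurable borel" using F'm by simp
  have [measurable]: "F' \<in> borel_measurable lebesgue" using F'm by (rule measurable_completion)
  have [measurable]: "F \<in> borel_measurable lebesgue" using F by (rule borel_measurable_integrable)
  have ae': "AE x in lebesgue. F x = F' x" using ae by (rule AE_completion)
  have "integrable lebesgue F'"
    using F integrable_cong_AE[of F lebesgue F'] ae' by simp
  then have F': "integrable lborel F'"
    using integrable_completion[OF F'm] by simp
  have transfer: "(LINT x|lborel. indicator A x * F' x) = (LINT x|lebesgue. indicator A x * F x)"
    if [measurable]: "A \<in> sets borel" for A
  proof -
    have "(LINT x|lborel. indicator A x * F' x) = (LINT x|lebesgue. indicator A x * F' x)"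
      by (rule integral_completion[symmetric]) simp
    also have "\<dots> = (LINT x|lebesgue. indicator A x * F x)"
    proof (rule integral_cong_AE)
      have A': "A \<in> sets lebesgue" using that by simp
      show "(\<lambda>x. indicator A x * F' x) \<in> borel_measurable lebesgue"
        "(\<lambda>x. indicator A x * F x) \<in> borel_measurable lebesgue"
        by (intro borel_measurable_times borel_measurable_indicator A', fact)+
      show "AE x in lebesgue. indicat_real A x * F' x = indicat_real A x * F x"
        using ae' by eventually_elim simp
    qed
    finally show ?thesis .
  qed
  let ?E = "range (\<lambda>(a, b). box a b :: 'a set)"
  have sets_E: "sets borel = sigma_sets UNIV ?E" by (simp add: borel_eq_box)
  have zero: "(LINT x:A|lborel. F' x) = 0" if "A \<in> sigma_sets UNIV ?E" for A
  proof (rule sigma_sets_induct_disjoint[OF _ _ that])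
    show "Int_stable ?E" by (auto simp: Int_stable_def box_Int_box)
    show "(LINT x:A|lborel. F' x) = 0" if "A \<in> ?E" for A
      using that box transfer by (auto simp: set_lebesgue_integral_def)
    show "(LINT x:{}|lborel. F' x) = 0" by (simp add: set_lebesgue_integral_def)
  next
    fix A assume A: "A \<in> sigma_sets UNIV ?E" "(LINT x:A|lborel. F' x) = 0"
    then have [measurable]: "A \<in> sets borel" by (simp only: sets_E)
    have "(LINT x|lborel. F' x) = 0"
      using transfer[of UNIV] UNIV by simp
    moreover have "(LINT x|lborel. F' x) = (LINT x:A|lborel. F' x) + (LINT x:UNIV - A|lborel. F' x)"
    proof -
      have "(LINT x|lborel. F' x) = (LINT x|lborel. indicator A x *\<^sub>R F' x + indicator (UNIV - A) x *\<^sub>R F' x)"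
        by (rule Bochner_Integration.integral_cong) (auto simp: indicator_def)
      also have "\<dots> = (LINT x:A|lborel. F' x) + (LINT x:UNIV - A|lborel. F' x)"
        unfolding set_lebesgue_integral_def
        by (intro Bochner_Integration.integral_add integrable_mult_indicator F') auto
      finally show ?thesis .
    qed
    ultimately show "(LINT x:UNIV - A|lborel. F' x) = 0" using A by simp
  next
    fix A :: "nat \<Rightarrow> 'a set"
    assume A: "disjoint_family A" "range A \<subseteq> sigma_sets UNIV ?E" "\<And>i. (LINT x:A i|lborel. F' x) = 0"
    then have [measurable]: "A i \<in> sets borel" for i unfolding sets_E by blast
    have "(LINT x:(\<Union>i. A i)|lborel. F' x) = (\<Sum>i. (LINT x:A i|lborel. F' x))"
    proof (rule lebesgue_integral_countable_add)
      show "set_integrable lborel (\<Union> (range A)) F'"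
        unfolding set_integrable_def by (intro integrable_mult_indicator F') auto
    qed (use A in \<open>auto simp: disjoint_family_on_def\<close>)
    then show "(LINT x:(\<Union>i. A i)|lborel. F' x) = 0" using A(3) by simp
  qed auto
  have "AE x in lborel. F' x = 0"
    by (rule sigma_finite_measure.density_zero[OF sigma_finite_lborel F']) (use zero in \<open>simp add: sets_E\<close>)
  then have "AE x in lebesgue. F' x = 0" by (rule AE_completion)
  with ae' show ?thesis by eventually_elim simp
qed

text \<open>
  The fundamental lemma of the calculus of variations: test functions approximate the indicator of
  a box boundedly, so \<open>f\<close> has integral zero over every box. The function is cut down to large boxes because
  it is integrable only locally.
\<close>

lemma AE_zero_if_test_integrals_zero:
  fixes f :: "'a::euclidean_space \<Rightarrow> real"
  assumes f: "locally_integrable f"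
    and test: "\<And>\<phi>. test_function \<phi> \<Longrightarrow> (LINT x|lebesgue. f x * \<phi> x) = 0"
  shows "AE x in lebesgue. f x = 0"
proof -
  have [measurable]: "f \<in> borel_measurable lebesgue"
    using f by (rule locally_integrable_measurable)
  have int: "integrable lebesgue (\<lambda>x. indicator (box a b) x * f x)" for a b
  proof -
    have "set_integrable lebesgue (cbox a b) f"
      using f by (simp add: locally_integrable_def)
    then have "set_integrable lebesgue (box a b) f"
      by (rule set_integrable_subset) (auto simp: box_subset_cbox)
    then show ?thesis by (simp add: set_integrable_def)
  qed
  have zero: "(LINT x|lebesgue. indicator (box a b) x * f x) = 0" for a b
  proof -
    obtain \<phi> where \<phi>: "\<And>n. test_function (\<phi> n)" "\<And>n x. \<bar>\<phi> n x\<bar> \<le> indicator (box a b) x"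
      "\<And>x. (\<lambda>n. \<phi> n x) \<longlonglongrightarrow> indicator (box a b) x"
      using test_function_box_approximation[of a b] by blast
    have "(\<lambda>n. LINT x|lebesgue. f x * \<phi> n x) \<longlonglongrightarrow> (LINT x|lebesgue. f x * indicator (box a b) x)"
    proof (rule integral_dominated_convergence)
      show "integrable lebesgue (\<lambda>x. \<bar>indicator (box a b) x * f x\<bar>)" using int by (rule integrable_abs)
      show "AE x in lebesgue. (\<lambda>n. f x * \<phi> n x) \<longlonglongrightarrow> f x * indicator (box a b) x"
        by (intro AE_I2 tendsto_intros \<phi>(3))
      show "AE x in lebesgue. norm (f x * \<phi> n x) \<le> \<bar>indicator (box a b) x * f x\<bar>" for n
        using mult_left_mono[OF \<phi>(2)[of n], of "\<bar>f _\<bar>"]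
        by (intro AE_I2) (simp add: abs_mult mult.commute)
      have "\<phi> n \<in> borel_measurable lborel" for n
        using \<phi>(1)[of n] Ck_continuous[of 0 "\<phi> n"] unfolding test_function_iff
        by (simp add: borel_measurable_continuous_onI)
      from measurable_completion[OF this] show "(\<lambda>x. f x * \<phi> n x) \<in> borel_measurable lebesgue" for n
        by measurable
      have "box a b \<in> sets lebesgue" by simp
      then show "(\<lambda>x. f x * indicat_real (box a b) x) \<in> borel_measurable lebesgue" by measurable
    qed
    moreover have "(LINT x|lebesgue. f x * \<phi> n x) = 0" for n by (rule test[OF \<phi>(1)])
    ultimately show ?thesis by (simp add: LIMSEQ_const_iff mult.commute)
  qed
  define B where "B n = box (- (real n *\<^sub>R One)) (real n *\<^sub>R One :: 'a)" for n
  have "AE x in lebesgue. indicator (B n) x * f x = 0" for n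
  proof (rule AE_zero_if_box_integrals_zero)
    show "integrable lebesgue (\<lambda>x. indicator (B n) x * f x)" "(LINT x|lebesgue. indicator (B n) x * f x) = 0"
      unfolding B_def by (rule int zero)+
    show "(LINT x|lebesgue. indicator (box a b) x * (indicator (B n) x * f x)) = 0" for a b
    proof -
      obtain a' b' where "box a b \<inter> B n = box a' b'" unfolding B_def box_Int_box by blast
      then have "indicator (box a b) x * (indicator (B n) x * f x) = indicator (box a' b') x * f x" for x
        by (metis indicator_inter_arith mult.assoc)
      then show ?thesis using zero[of a' b'] by (simp only:)
    qed
  qed
  then have "AE x in lebesgue. \<forall>n. indicator (B n) x * f x = 0"
    unfolding AE_all_countable by blast
  then show ?thesis
  proof eventually_elim
    case (elim x)
    have "x \<in> (\<Union>n. B n)" unfolding B_def using UN_box_eq_UNIV by blast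
    then obtain n where "x \<in> B n" by blast
    then show ?case using elim[rule_format, of n] by simp
  qed
qed

lemma has_weak_gradient_unique:
  fixes u :: "'a::euclidean_space \<Rightarrow> real"
  assumes g: "has_weak_gradient u g" and g': "has_weak_gradient u g'"
  shows "AE x in lebesgue. g x = g' x"
proof -
  have li: "locally_integrable g" "locally_integrable g'"
    using g g' by (auto simp: has_weak_gradient_def)
  have "AE x in lebesgue. (g x - g' x) \<bullet> b = 0" if b: "b \<in> Basis" for b
  proof (rule AE_zero_if_test_integrals_zero)
    show "locally_integrable (\<lambda>x. (g x - g' x) \<bullet> b)"
      by (intro locally_integrable_inner locally_integrable_diff li)
    fix \<phi> :: "'a \<Rightarrow> real" assume \<phi>: "test_function \<phi>"
    have c: "continuous_on UNIV \<phi>" "bounded {x. \<phi> x \<noteq> 0}"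
      using \<phi> Ck_continuous by (auto simp: test_function_iff)
    have i: "integrable lebesgue (\<lambda>x. (g x \<bullet> b) * \<phi> x)" "integrable lebesgue (\<lambda>x. (g' x \<bullet> b) * \<phi> x)"
      by (intro locally_integrable_mult_integrable locally_integrable_inner li c)+
    have "(LINT x|lebesgue. (g x \<bullet> b) * \<phi> x) = (LINT x|lebesgue. (g' x \<bullet> b) * \<phi> x)"
      proof -
      have "- (LINT x|lebesgue. (g x \<bullet> b) * \<phi> x) = - (LINT x|lebesgue. (g' x \<bullet> b) * \<phi> x)"
        using g g' \<phi> b unfolding has_weak_gradient_def by simp
      then show ?thesis by simp
    qed
    then show "(LINT x|lebesgue. (g x - g' x) \<bullet> b * \<phi> x) = 0"
      using i by (simp add: inner_diff_left left_diff_distrib)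
  qed
  then have "AE x in lebesgue. \<forall>b\<in>Basis. (g x - g' x) \<bullet> b = 0"
    by (intro AE_finite_allI) auto
  then show ?thesis
    by eventually_elim (use euclidean_all_zero_iff right_minus_eq in blast)
qed

lemma has_weak_gradient_weak_gradient: "has_weak_gradient u g \<Longrightarrow> has_weak_gradient u (weak_gradient u)"
  unfolding weak_gradient_def by (rule someI[of "has_weak_gradient u"])

lemma weak_gradient_AE: "has_weak_gradient u g \<Longrightarrow> AE x in lebesgue. weak_gradient u x = g x"
  using has_weak_gradient_unique has_weak_gradient_weak_gradient by blast

lemma has_weak_gradient_diff:
  assumes u: "has_weak_gradient u g" and v: "has_weak_gradient v h"
  shows "has_weak_gradient (\<lambda>x. u x - v x) (\<lambda>x. g x - h x)"
  unfolding has_weak_gradient_def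
proof (intro conjI allI impI)
  have li: "locally_integrable u" "locally_integrable v" "locally_integrable g" "locally_integrable h"
    using u v by (auto simp: has_weak_gradient_def)
  then show "locally_integrable (\<lambda>x. u x - v x)" "locally_integrable (\<lambda>x. g x - h x)"
    by (auto intro: locally_integrable_diff)
  fix \<phi> :: "'a \<Rightarrow> real" and b :: 'a assume \<phi>: "test_function \<phi>" and b: "b \<in> Basis"
  have c: "continuous_on UNIV \<phi>" "bounded {x. \<phi> x \<noteq> 0}"
    using \<phi> Ck_continuous by (auto simp: test_function_iff)
  have "Ck 1 \<phi>" using \<phi> by (simp add: test_function_iff)
  then have d: "continuous_on UNIV (\<lambda>x. frechet_derivative \<phi> (at x) b)"
    using Ck_Suc_partial[of 0 \<phi> b] b by simp
  have d': "bounded {x. frechet_derivative \<phi> (at x) b \<noteq> 0}"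
    by (rule bounded_subset[OF bounded_support_frechet_derivative[OF c(2)]]) auto
  note i = locally_integrable_mult_integrable[OF li(1) d d']
    locally_integrable_mult_integrable[OF li(2) d d']
    locally_integrable_mult_integrable[OF locally_integrable_inner[OF li(3), of b] c]
    locally_integrable_mult_integrable[OF locally_integrable_inner[OF li(4), of b] c]
  have "(LINT x|lebesgue. u x * frechet_derivative \<phi> (at x) b) = - (LINT x|lebesgue. (g x \<bullet> b) * \<phi> x)"
    "(LINT x|lebesgue. v x * frechet_derivative \<phi> (at x) b) = - (LINT x|lebesgue. (h x \<bullet> b) * \<phi> x)"
    using u v \<phi> b by (auto simp: has_weak_gradient_def)
  then show "(LINT x|lebesgue. (u x - v x) * frechet_derivative \<phi> (at x) b)
      = - (LINT x|lebesgue. ((g x - h x) \<bullet> b) * \<phi> x)"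
    using i by (simp add: inner_diff_left left_diff_distrib)
qed

lemma test_function_has_weak_gradient:
  fixes \<phi> :: "'a::euclidean_space \<Rightarrow> real"
  assumes \<phi>: "test_function \<phi>"
  shows "has_weak_gradient \<phi> (grad \<phi>)"
  unfolding has_weak_gradient_def
proof (intro conjI allI impI)
  have C: "Ck (Suc 0) \<phi>" "bounded {x. \<phi> x \<noteq> 0}" using \<phi> unfolding test_function_iff by blast+
  show "locally_integrable \<phi>" "locally_integrable (grad \<phi>)"
    by (intro continuous_imp_locally_integrable Ck_continuous[OF C(1)] continuous_grad[OF C(1)])+
  fix \<psi> :: "'a \<Rightarrow> real" and b :: 'a assume \<psi>: "test_function \<psi>" and b: "b \<in> Basis"
  have D: "Ck (Suc 0) \<psi>" using \<psi> unfolding test_function_iff by blast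
  note [measurable] = borel_measurable_continuous_onI[OF Ck_continuous[OF C(1)]]
    borel_measurable_continuous_onI[OF Ck_continuous[OF D]]
    borel_measurable_continuous_onI[OF continuous_grad[OF C(1)]]
    borel_measurable_continuous_onI[OF continuous_grad[OF D]]
  show "(LINT x|lebesgue. \<phi> x * frechet_derivative \<psi> (at x) b) = - (LINT x|lebesgue. (grad \<phi> x \<bullet> b) * \<psi> x)"
    using integration_by_parts[OF C(1) D C(2), of b]
    by (simp add: grad_inner_Basis[OF b, symmetric] integral_completion)
qed

lemma dirichlet_energy_eq:
  assumes "has_weak_gradient u g"
  shows "dirichlet_energy u = (\<integral>\<^sup>+x. ennreal ((norm (g x))\<^sup>2) \<partial>lebesgue)"
  unfolding dirichlet_energy_def
  by (rule nn_integral_cong_AE) (use weak_gradient_AE[OF assms] in eventually_elim, simp)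

lemma test_function_in_D12:
  assumes "test_function \<phi>"
  shows "\<phi> \<in> D12"
proof -
  note w = test_function_has_weak_gradient[OF assms]
  have "dirichlet_energy (\<lambda>x. \<phi> x - \<phi> x) = 0"
    by (subst dirichlet_energy_eq[OF has_weak_gradient_diff[OF w w]]) simp
  then show ?thesis
    unfolding D12_def using assms w by (auto intro!: exI[of _ "\<lambda>_. \<phi>"])
qed

text \<open>
  The definition of the space speaks of the energy of \<open>\<phi>\<^sub>k - u\<close>; by uniqueness it can be computed with the
  difference of the classical gradient and the weak gradient.
\<close>

lemma D12_approximation:
  fixes u :: "'a::euclidean_space \<Rightarrow> real"
  assumes "u \<in> D12"
  obtains \<phi> where "\<And>k::nat. test_function (\<phi> k)"
    "\<And>K. compact K \<Longrightarrow> (\<lambda>k. \<integral>\<^sup>+x\<in>K. ennreal \<bar>\<phi> k x - u x\<bar> \<partial>lebesgue) \<longlonglongrightarrow> 0"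
    "(\<lambda>k. \<integral>\<^sup>+x. ennreal ((norm (grad (\<phi> k) x - weak_gradient u x))\<^sup>2) \<partial>lebesgue) \<longlonglongrightarrow> 0"
    "has_weak_gradient u (weak_gradient u)"
proof -
  obtain g \<phi> where g: "has_weak_gradient u g" and \<phi>: "\<And>k::nat. test_function (\<phi> k)"
    "\<And>K. compact K \<Longrightarrow> (\<lambda>k. \<integral>\<^sup>+x\<in>K. ennreal \<bar>\<phi> k x - u x\<bar> \<partial>lebesgue) \<longlonglongrightarrow> 0"
    "(\<lambda>k. dirichlet_energy (\<lambda>x. \<phi> k x - u x)) \<longlonglongrightarrow> 0"
    using assms by (auto simp: D12_def)
  note w = has_weak_gradient_weak_gradient[OF g]
  show thesis
  proof (rule that[OF \<phi>(1,2) _ w])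
    show "(\<lambda>k. \<integral>\<^sup>+x. ennreal ((norm (grad (\<phi> k) x - weak_gradient u x))\<^sup>2) \<partial>lebesgue) \<longlonglongrightarrow> 0"
      using \<phi>(3) dirichlet_energy_eq[OF has_weak_gradient_diff[OF test_function_has_weak_gradient[OF \<phi>(1)] w]]
      by simp
  qed
qed

section \<open>Hardy's inequality with remainder on the closure\<close>

lemma nn_integral_le_of_AE_limit:
  fixes f :: "nat \<Rightarrow> 'a \<Rightarrow> ennreal"
  assumes meas: "\<And>n. f n \<in> borel_measurable M"
    and lim: "AE x in M. (\<lambda>n. f n x) \<longlonglongrightarrow> g x"
    and le: "\<And>n. (\<integral>\<^sup>+x. f n x \<partial>M) \<le> b n" and b: "b \<longlonglongrightarrow> B"
  shows "(\<integral>\<^sup>+x. g x \<partial>M) \<le> B"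
proof -
  have "(\<integral>\<^sup>+x. g x \<partial>M) = (\<integral>\<^sup>+x. liminf (\<lambda>n. f n x) \<partial>M)"
    by (rule nn_integral_cong_AE) (use lim in eventually_elim, simp add: lim_imp_Liminf)
  also have "\<dots> \<le> liminf (\<lambda>n. \<integral>\<^sup>+x. f n x \<partial>M)"
    by (rule nn_integral_liminf) (rule meas)
  also have "\<dots> \<le> liminf b"
    by (rule Liminf_mono) (simp add: le)
  also have "\<dots> = B" using b by (simp add: lim_imp_Liminf)
  finally show ?thesis .
qed

lemma norm_add_sq_le:
  fixes a b :: "'a::real_inner"
  assumes "\<eta> > 0"
  shows "(norm (a + b))\<^sup>2 \<le> (1 + \<eta>) * (norm a)\<^sup>2 + (1 + 1 / \<eta>) * (norm b)\<^sup>2"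
proof -
  have "0 \<le> (norm (\<eta> *\<^sub>R a - b))\<^sup>2 / \<eta>" using assms by simp
  also have "\<dots> = \<eta> * (norm a)\<^sup>2 - 2 * (a \<bullet> b) + (norm b)\<^sup>2 / \<eta>"
    using assms unfolding power2_norm_eq_inner
    by (simp add: inner_diff_left inner_diff_right inner_commute field_simps power2_eq_square)
  finally show ?thesis
    unfolding power2_norm_eq_inner
    by (simp add: inner_add_left inner_add_right inner_commute algebra_simps)
qed

text \<open>
  A triangle inequality for squared norms: the factor of the first term is as close to 1 as desired, so
  it bounds the energy of an approximation by the energy of the limit plus a vanishing error without
  taking square roots of integrals.
\<close>

lemma nn_integral_norm_add_sq_le:
  fixes f g :: "'a \<Rightarrow> 'b::euclidean_space"
  assumes [measurable]: "f \<in> borel_measurable M" "g \<in> borel_measurable M" and \<eta>: "\<eta> > 0"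
  shows "(\<integral>\<^sup>+x. ennreal ((norm (f x + g x))\<^sup>2) \<partial>M)
    \<le> ennreal (1 + \<eta>) * (\<integral>\<^sup>+x. ennreal ((norm (f x))\<^sup>2) \<partial>M)
      + ennreal (1 + 1 / \<eta>) * (\<integral>\<^sup>+x. ennreal ((norm (g x))\<^sup>2) \<partial>M)"
proof -
  have "(\<integral>\<^sup>+x. ennreal ((norm (f x + g x))\<^sup>2) \<partial>M)
      \<le> (\<integral>\<^sup>+x. ennreal (1 + \<eta>) * ennreal ((norm (f x))\<^sup>2) + ennreal (1 + 1 / \<eta>) * ennreal ((norm (g x))\<^sup>2) \<partial>M)"
    using \<eta> norm_add_sq_le[OF \<eta>]
    by (intro nn_integral_mono) (simp add: ennreal_leI flip: ennreal_mult' ennreal_plus)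
  also have "\<dots> = ennreal (1 + \<eta>) * (\<integral>\<^sup>+x. ennreal ((norm (f x))\<^sup>2) \<partial>M)
      + ennreal (1 + 1 / \<eta>) * (\<integral>\<^sup>+x. ennreal ((norm (g x))\<^sup>2) \<partial>M)"
    by (simp add: nn_integral_add nn_integral_cmult)
  finally show ?thesis .
qed

lemma test_function_energy_finite:
  assumes "test_function \<phi>"
  shows "(\<integral>\<^sup>+x. ennreal ((norm (grad \<phi> x))\<^sup>2) \<partial>lebesgue) < \<infinity>"
proof -
  have C: "Ck (Suc 0) \<phi>" "bounded {x. \<phi> x \<noteq> 0}" using assms unfolding test_function_iff by blast+
  have "integrable lborel (\<lambda>y. (norm (grad \<phi> y))\<^sup>2)"
    by (rule integrable_bounded_support)
       (auto intro!: continuous_intros continuous_grad[OF C(1)] bounded_support_grad[OF C(2)])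
  then show ?thesis
    by (simp add: nn_integral_completion nn_integral_eq_integral)
qed

text \<open>
  The weak gradient is at finite distance from the gradient of some test function.
\<close>

lemma D12_energy_finite:
  fixes u :: "'a::euclidean_space \<Rightarrow> real"
  assumes "u \<in> D12"
  shows "(\<integral>\<^sup>+x. ennreal ((norm (weak_gradient u x))\<^sup>2) \<partial>lebesgue) < \<infinity>"
proof -
  obtain \<phi> where \<phi>: "\<And>k::nat. test_function (\<phi> k)"
    "(\<lambda>k. \<integral>\<^sup>+x. ennreal ((norm (grad (\<phi> k) x - weak_gradient u x))\<^sup>2) \<partial>lebesgue) \<longlonglongrightarrow> 0"
    "has_weak_gradient u (weak_gradient u)"
    by (rule D12_approximation[OF assms]) blast
  have [measurable]: "weak_gradient u \<in> borel_measurable lebesgue" "grad (\<phi> k) \<in> borel_measurable lebesgue" for k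
    using \<phi>(3) test_function_has_weak_gradient[OF \<phi>(1)] locally_integrable_measurable
    by (auto simp: has_weak_gradient_def)
  obtain k where k: "(\<integral>\<^sup>+x. ennreal ((norm (grad (\<phi> k) x - weak_gradient u x))\<^sup>2) \<partial>lebesgue) < 1"
    using order_tendstoD(2)[OF \<phi>(2), of 1] by (auto simp: eventually_sequentially)
  have "(\<integral>\<^sup>+x. ennreal ((norm (weak_gradient u x))\<^sup>2) \<partial>lebesgue)
      = (\<integral>\<^sup>+x. ennreal ((norm (grad (\<phi> k) x + (weak_gradient u x - grad (\<phi> k) x)))\<^sup>2) \<partial>lebesgue)"
    by simp
  also have "\<dots> \<le> ennreal (1 + 1) * (\<integral>\<^sup>+x. ennreal ((norm (grad (\<phi> k) x))\<^sup>2) \<partial>lebesgue)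
      + ennreal (1 + 1 / 1) * (\<integral>\<^sup>+x. ennreal ((norm (weak_gradient u x - grad (\<phi> k) x))\<^sup>2) \<partial>lebesgue)"
    by (rule nn_integral_norm_add_sq_le) auto
  also have "\<dots> < \<infinity>"
    using test_function_energy_finite[OF \<phi>(1)[of k]] k
    by (auto simp: norm_minus_commute ennreal_mult_less_top ennreal_add_less_top intro: order.strict_trans)
  finally show ?thesis .
qed

text \<open>
  Fatou's lemma along the approximating test functions \<open>\<phi>\<^sub>k\<close>, with the regularisation \<open>\<epsilon>\<^sub>k\<close> tending to zero at
  the same time. Pointwise convergence of \<open>\<phi>\<^sub>k\<close> is available along subsequences on a fixed ball only, so
  the inequality is proved on balls first.
\<close>

lemma hardy_with_remainder:
  fixes u :: "'a::euclidean_space \<Rightarrow> real" and p :: 'a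
  assumes u: "u \<in> D12" and c: "c = (real DIM('a) - 2) / 2" "c \<ge> 0"
  shows "(\<integral>\<^sup>+y. ennreal ((norm (weak_gradient u y + (c * u y / (norm (y - p))\<^sup>2) *\<^sub>R (y - p)))\<^sup>2
            + c\<^sup>2 * (u y)\<^sup>2 / (norm (y - p))\<^sup>2) \<partial>lebesgue)
          \<le> (\<integral>\<^sup>+y. ennreal ((norm (weak_gradient u y))\<^sup>2) \<partial>lebesgue)" (is "_ \<le> ?E")
proof -
  define g where "g = weak_gradient u"
  obtain \<phi> where \<phi>: "\<And>k::nat. test_function (\<phi> k)"
    "\<And>K. compact K \<Longrightarrow> (\<lambda>k. \<integral>\<^sup>+x\<in>K. ennreal \<bar>\<phi> k x - u x\<bar> \<partial>lebesgue) \<longlonglongrightarrow> 0"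
    "(\<lambda>k. \<integral>\<^sup>+x. ennreal ((norm (grad (\<phi> k) x - g x))\<^sup>2) \<partial>lebesgue) \<longlonglongrightarrow> 0"
    "has_weak_gradient u g"
    unfolding g_def by (rule D12_approximation[OF u]) blast
  have C: "Ck (Suc 0) (\<phi> k)" "bounded {x. \<phi> k x \<noteq> 0}" for k
    using \<phi>(1)[of k] unfolding test_function_iff by blast+
  have li: "locally_integrable u" "locally_integrable g" using \<phi>(4) by (auto simp: has_weak_gradient_def)
  have [measurable]: "u \<in> borel_measurable lebesgue" "g \<in> borel_measurable lebesgue"
    using li locally_integrable_measurable by auto
  have \<phi>b: "\<phi> k \<in> borel_measurable lborel" "grad (\<phi> k) \<in> borel_measurable lborel" for k
    using Ck_continuous[OF C(1)] continuous_grad[OF C(1)] by (auto simp: borel_measurable_continuous_onI)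
  note [measurable] = measurable_completion[OF \<phi>b(1)] measurable_completion[OF \<phi>b(2)]
  define h where "h \<epsilon> v a y = (norm (a + (c * v / ((norm (y - p))\<^sup>2 + \<epsilon>)) *\<^sub>R (y - p)))\<^sup>2
      + c\<^sup>2 * v\<^sup>2 / ((norm (y - p))\<^sup>2 + \<epsilon>)" for \<epsilon> v a y
  define d where "d k = (\<integral>\<^sup>+x. ennreal ((norm (grad (\<phi> k) x - g x))\<^sup>2) \<partial>lebesgue)" for k
  define \<epsilon> where "\<epsilon> k = 1 / real (Suc k)" for k
  have \<epsilon>: "\<epsilon> k > 0" for k by (simp add: \<epsilon>_def)
  have \<epsilon>0: "\<epsilon> \<longlonglongrightarrow> 0" unfolding \<epsilon>_def by (rule LIMSEQ_Suc[OF lim_1_over_n])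
  have Efin: "?E < \<infinity>" by (rule D12_energy_finite[OF u])
  have h_meas: "(\<lambda>y. h (\<epsilon> k) (\<phi> k y) (grad (\<phi> k) y) y) \<in> borel_measurable lebesgue" for k
  proof (rule measurable_completion)
    note [measurable] = \<phi>b
    show "(\<lambda>y. h (\<epsilon> k) (\<phi> k y) (grad (\<phi> k) y) y) \<in> borel_measurable lborel"
      unfolding h_def by measurable
  qed
  have h_le: "(\<integral>\<^sup>+y. ennreal (h (\<epsilon> k) (\<phi> k y) (grad (\<phi> k) y) y) \<partial>lebesgue)
      \<le> ennreal (1 + \<eta>) * ?E + ennreal (1 + 1 / \<eta>) * d k" if \<eta>: "\<eta> > 0" for k \<eta>
  proof -
    have "(\<integral>\<^sup>+y. ennreal (h (\<epsilon> k) (\<phi> k y) (grad (\<phi> k) y) y) \<partial>lebesgue)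
        \<le> (\<integral>\<^sup>+y. ennreal ((norm (grad (\<phi> k) y))\<^sup>2) \<partial>lebesgue)"
      unfolding h_def nn_integral_completion
      by (rule hardy_test_function_regularised[OF C \<epsilon> c])
    also have "\<dots> = (\<integral>\<^sup>+y. ennreal ((norm (g y + (grad (\<phi> k) y - g y)))\<^sup>2) \<partial>lebesgue)" by simp
    also have "\<dots> \<le> ennreal (1 + \<eta>) * ?E + ennreal (1 + 1 / \<eta>) * d k"
      unfolding d_def g_def[symmetric] by (rule nn_integral_norm_add_sq_le) (auto simp: \<eta>)
    finally show ?thesis .
  qed
  have K_le: "(\<integral>\<^sup>+y. indicator (cball 0 R) y * ennreal (h 0 (u y) (g y) y) \<partial>lebesgue) \<le> ennreal (1 + \<eta>) * ?E"
    if \<eta>: "\<eta> > 0" for \<eta> R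
  proof -
    define K where "K = cball (0::'a) R"
    have K[measurable]: "K \<in> sets lebesgue" by (simp add: K_def)
    \<comment> \<open>One function that controls both \<open>\<phi>\<^sub>k - u\<close> on \<open>K\<close> and the gradients, so that one subsequence serves for both.\<close>
    define w where "w k y = indicator K y * \<bar>\<phi> k y - u y\<bar> + (norm (grad (\<phi> k) y - g y))\<^sup>2" for k y
    have w_meas[measurable]: "w k \<in> borel_measurable lebesgue" for k unfolding w_def by measurable
    have w_nn: "w k y \<ge> 0" for k y by (simp add: w_def)
    have w_eq: "(\<integral>\<^sup>+y. ennreal (w k y) \<partial>lebesgue) = (\<integral>\<^sup>+x\<in>K. ennreal \<bar>\<phi> k x - u x\<bar> \<partial>lebesgue) + d k" for k
    proof -
      have "(\<integral>\<^sup>+y. ennreal (w k y) \<partial>lebesgue) =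
        (\<integral>\<^sup>+y. ennreal \<bar>\<phi> k y - u y\<bar> * indicator K y + ennreal ((norm (grad (\<phi> k) y - g y))\<^sup>2) \<partial>lebesgue)"
        by (rule nn_integral_cong) (auto simp: w_def indicator_def ennreal_plus[symmetric] simp del: ennreal_plus)
      also have "\<dots> = (\<integral>\<^sup>+x\<in>K. ennreal \<bar>\<phi> k x - u x\<bar> \<partial>lebesgue) + d k"
        unfolding d_def by (rule nn_integral_add) measurable
      finally show ?thesis .
    qed
    have w_lim: "(\<lambda>k. \<integral>\<^sup>+y. ennreal (w k y) \<partial>lebesgue) \<longlonglongrightarrow> 0"
      unfolding w_eq using tendsto_add[OF \<phi>(2)[of K] \<phi>(3)] by (simp add: K_def d_def)
    \<comment> \<open>The integrals are finite from some index on.\<close>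
    obtain k0 where k0: "\<And>k. k \<ge> k0 \<Longrightarrow> (\<integral>\<^sup>+y. ennreal (w k y) \<partial>lebesgue) < 1"
      using order_tendstoD(2)[OF w_lim, of 1] by (auto simp: eventually_sequentially)
    have w_int: "integrable lebesgue (w (k + k0))" for k
      using k0[of "k + k0"] w_nn
      by (intro integrableI_nonneg) (auto intro: order.strict_trans)
    have "\<exists>r::nat\<Rightarrow>nat. strict_mono r \<and> (AE x in lebesgue. (\<lambda>n. w (r n + k0) x) \<longlonglongrightarrow> 0)"
    proof (rule tendsto_L1_AE_subseq[OF w_int])
      have "(\<lambda>k. \<integral>\<^sup>+y. ennreal (w (k + k0) y) \<partial>lebesgue) \<longlonglongrightarrow> ennreal 0"
        using LIMSEQ_ignore_initial_segment[OF w_lim, of k0] by simp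
      from tendsto_enn2real[OF this]
      have "(\<lambda>k. enn2real (\<integral>\<^sup>+y. ennreal (w (k + k0) y) \<partial>lebesgue)) \<longlonglongrightarrow> 0" by simp
      then show "(\<lambda>k. LINT x|lebesgue. norm (w (k + k0) x)) \<longlonglongrightarrow> 0"
        using w_nn by (simp add: integral_eq_nn_integral)
    qed
    then obtain r where r: "strict_mono (r :: nat \<Rightarrow> nat)"
      and ae: "AE x in lebesgue. (\<lambda>n. w (r n + k0) x) \<longlonglongrightarrow> 0" by blast
    define s where "s n = r n + k0" for n
    have s: "filterlim s at_top sequentially"
      unfolding s_def using filterlim_subseq[OF r] filterlim_compose[OF filterlim_add_const_nat_at_top] by blast
    have "(\<integral>\<^sup>+y. indicator K y * ennreal (h 0 (u y) (g y) y) \<partial>lebesgue) \<le> ennreal (1 + \<eta>) * ?E + ennreal (1 + 1 / \<eta>) * 0"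
    proof (rule nn_integral_le_of_AE_limit)
      show "(\<lambda>y. indicator K y * ennreal (h (\<epsilon> (s n)) (\<phi> (s n) y) (grad (\<phi> (s n)) y) y)) \<in> borel_measurable lebesgue" for n
        using h_meas by measurable
      show "(\<integral>\<^sup>+y. indicator K y * ennreal (h (\<epsilon> (s n)) (\<phi> (s n) y) (grad (\<phi> (s n)) y) y) \<partial>lebesgue)
          \<le> ennreal (1 + \<eta>) * ?E + ennreal (1 + 1 / \<eta>) * d (s n)" for n
        by (rule order_trans[OF nn_integral_mono h_le[OF \<eta>]]) (auto simp: indicator_def)
      have "(\<lambda>n. d (s n)) \<longlonglongrightarrow> 0"
        using filterlim_compose[OF \<phi>(3) s] by (simp add: d_def)
      then show "(\<lambda>n. ennreal (1 + \<eta>) * ?E + ennreal (1 + 1 / \<eta>) * d (s n))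
          \<longlonglongrightarrow> ennreal (1 + \<eta>) * ?E + ennreal (1 + 1 / \<eta>) * 0"
        by (intro tendsto_add tendsto_const ennreal_tendsto_cmult) auto
      have "AE y in lebesgue. y \<noteq> p" by (rule AE_completion[OF AE_lborel_singleton])
      with ae show "AE y in lebesgue. (\<lambda>n. indicator K y * ennreal (h (\<epsilon> (s n)) (\<phi> (s n) y) (grad (\<phi> (s n)) y) y))
          \<longlonglongrightarrow> indicator K y * ennreal (h 0 (u y) (g y) y)"
      proof eventually_elim
        case (elim y)
        have w0: "(\<lambda>n. w (s n) y) \<longlonglongrightarrow> 0" using elim by (simp add: s_def)
        show ?case
        proof (cases "y \<in> K")
          case True
          have "(\<lambda>n. \<bar>\<phi> (s n) y - u y\<bar>) \<longlonglongrightarrow> 0"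
            by (rule tendsto_sandwich[OF _ _ tendsto_const w0]) (auto simp: w_def True)
          then have 1: "(\<lambda>n. \<phi> (s n) y) \<longlonglongrightarrow> u y"
            by (simp add: LIM_zero_cancel tendsto_rabs_zero_iff)
          have "(\<lambda>n. (norm (grad (\<phi> (s n)) y - g y))\<^sup>2) \<longlonglongrightarrow> 0"
            by (rule tendsto_sandwich[OF _ _ tendsto_const w0]) (auto simp: w_def)
          from tendsto_real_sqrt[OF this] have "(\<lambda>n. norm (grad (\<phi> (s n)) y - g y)) \<longlonglongrightarrow> 0" by simp
          then have 2: "(\<lambda>n. grad (\<phi> (s n)) y) \<longlonglongrightarrow> g y"
            by (simp add: LIM_zero_cancel tendsto_norm_zero_iff)
          have 3: "(\<lambda>n. \<epsilon> (s n)) \<longlonglongrightarrow> 0" by (rule filterlim_compose[OF \<epsilon>0 s])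
          have "(\<lambda>n. h (\<epsilon> (s n)) (\<phi> (s n) y) (grad (\<phi> (s n)) y) y) \<longlonglongrightarrow> h 0 (u y) (g y) y"
            unfolding h_def using elim(2) by (intro tendsto_intros 1 2 3) auto
          then show ?thesis using True by (simp add: tendsto_ennrealI)
        qed simp
      qed
    qed
    then show ?thesis by (simp add: K_def)
  qed
  have K_le': "(\<integral>\<^sup>+y. indicator (cball 0 R) y * ennreal (h 0 (u y) (g y) y) \<partial>lebesgue) \<le> ?E" for R
  proof (rule ennreal_le_epsilon)
    fix e :: real assume e: "e > 0"
    define E' where "E' = enn2real ?E"
    have E': "?E = ennreal E'" "E' \<ge> 0" using Efin by (auto simp: E'_def)
    \<comment> \<open>This makes \<open>\<eta> E' \<le> e\<close>; the summand 1 covers the case of zero energy.\<close>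
    define \<eta> where "\<eta> = e / (E' + 1)"
    have \<eta>: "\<eta> > 0" using e E' by (simp add: \<eta>_def)
    have "(1 + \<eta>) * E' \<le> E' + e" using e E' by (simp add: \<eta>_def field_simps)
    then have "ennreal (1 + \<eta>) * ?E \<le> ?E + ennreal e"
      unfolding E'(1) using E'(2) e \<eta> by (simp flip: ennreal_mult ennreal_plus)
    with K_le[OF \<eta>, of R] show "(\<integral>\<^sup>+y. indicator (cball 0 R) y * ennreal (h 0 (u y) (g y) y) \<partial>lebesgue) \<le> ?E + ennreal e"
      by (rule order_trans)
  qed
  have "(\<integral>\<^sup>+y. ennreal (h 0 (u y) (g y) y) \<partial>lebesgue) \<le> ?E"
  proof (rule nn_integral_le_of_AE_limit[OF _ _ K_le' tendsto_const])
    show "(\<lambda>y. indicator (cball 0 (real n)) y * ennreal (h 0 (u y) (g y) y)) \<in> borel_measurable lebesgue" for n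
    proof -
      have [measurable]: "cball (0::'a) (real n) \<in> sets lebesgue" by simp
      have [measurable]: "(\<lambda>y. y - p) \<in> borel_measurable lebesgue"
        by (rule measurable_completion) measurable
      show ?thesis unfolding h_def by measurable
    qed
    show "AE y in lebesgue. (\<lambda>n. indicator (cball 0 (real n)) y * ennreal (h 0 (u y) (g y) y)) \<longlonglongrightarrow> ennreal (h 0 (u y) (g y) y)"
    proof (rule AE_I2)
      fix y :: 'a
      obtain N :: nat where "norm y \<le> real N" using real_arch_simple by blast
      then have "\<forall>n\<ge>N. indicator (cball 0 (real n)) y * ennreal (h 0 (u y) (g y) y) = ennreal (h 0 (u y) (g y) y)"
        by (auto simp: indicator_def)
      then show "(\<lambda>n. indicator (cball 0 (real n)) y * ennreal (h 0 (u y) (g y) y)) \<longlonglongrightarrow> ennreal (h 0 (u y) (g y) y)"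
        by (intro tendsto_eventually) (auto simp: eventually_sequentially)
    qed
  qed
  then show ?thesis by (simp add: h_def g_def)
qed

section \<open>Equality in Hardy's inequality\<close>

lemma hardy_at_point:
  fixes u :: "'a::euclidean_space \<Rightarrow> real" and p :: 'a
  assumes u: "u \<in> D12" and c: "c = (real DIM('a) - 2) / 2" "c \<ge> 0"
  shows "(\<integral>\<^sup>+y. ennreal (c\<^sup>2 * (u y)\<^sup>2 / (norm (y - p))\<^sup>2) \<partial>lebesgue)
          \<le> (\<integral>\<^sup>+y. ennreal ((norm (weak_gradient u y))\<^sup>2) \<partial>lebesgue)"
  by (rule order_trans[OF nn_integral_mono hardy_with_remainder[OF u c, of p]]) (auto intro!: ennreal_leI)

lemma D12_measurable:
  assumes "u \<in> D12"
  shows "u \<in> borel_measurable lebesgue" "weak_gradient u \<in> borel_measurable lebesgue"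
proof -
  have "has_weak_gradient u (weak_gradient u)" using assms has_weak_gradient_weak_gradient by (auto simp: D12_def)
  then show "u \<in> borel_measurable lebesgue" "weak_gradient u \<in> borel_measurable lebesgue"
    using locally_integrable_measurable by (auto simp: has_weak_gradient_def)
qed

lemma hardy_equality_at_point:
  fixes u :: "'a::euclidean_space \<Rightarrow> real" and p :: 'a
  assumes u: "u \<in> D12" and c: "c = (real DIM('a) - 2) / 2" "c \<ge> 0"
    and eq: "(\<integral>\<^sup>+y. ennreal (c\<^sup>2 * (u y)\<^sup>2 / (norm (y - p))\<^sup>2) \<partial>lebesgue)
          = (\<integral>\<^sup>+y. ennreal ((norm (weak_gradient u y))\<^sup>2) \<partial>lebesgue)" (is "?A = ?E")
  shows "AE y in lebesgue. weak_gradient u y + (c * u y / (norm (y - p))\<^sup>2) *\<^sub>R (y - p) = 0"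
proof -
  note [measurable] = D12_measurable[OF u]
  have [measurable]: "(\<lambda>y. y - p) \<in> borel_measurable lebesgue"
    by (rule measurable_completion) measurable
  let ?v = "\<lambda>y. weak_gradient u y + (c * u y / (norm (y - p))\<^sup>2) *\<^sub>R (y - p)"
  have "(\<integral>\<^sup>+y. ennreal ((norm (?v y))\<^sup>2) \<partial>lebesgue) + ?A
      = (\<integral>\<^sup>+y. ennreal ((norm (?v y))\<^sup>2) + ennreal (c\<^sup>2 * (u y)\<^sup>2 / (norm (y - p))\<^sup>2) \<partial>lebesgue)"
    by (rule nn_integral_add[symmetric]) measurable
  also have "\<dots> = (\<integral>\<^sup>+y. ennreal ((norm (?v y))\<^sup>2 + c\<^sup>2 * (u y)\<^sup>2 / (norm (y - p))\<^sup>2) \<partial>lebesgue)"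
    by (intro nn_integral_cong ennreal_plus[symmetric]) auto
  also have "\<dots> \<le> ?E" by (rule hardy_with_remainder[OF u c])
  finally have "(\<integral>\<^sup>+y. ennreal ((norm (?v y))\<^sup>2) \<partial>lebesgue) + ?E \<le> 0 + ?E" by (simp add: eq)
  then have "(\<integral>\<^sup>+y. ennreal ((norm (?v y))\<^sup>2) \<partial>lebesgue) = 0"
    using D12_energy_finite[OF u] unfolding add.commute[of _ ?E] ennreal_add_left_cancel_le by auto
  then have "AE y in lebesgue. ennreal ((norm (?v y))\<^sup>2) = 0"
    by (subst (asm) nn_integral_0_iff_AE) measurable
  then show ?thesis by eventually_elim simp
qed

lemma inversion_injective:
  fixes a b :: "'a::real_inner"
  assumes "a \<noteq> 0" "b \<noteq> 0" and eq: "(1 / (norm a)\<^sup>2) *\<^sub>R a = (1 / (norm b)\<^sup>2) *\<^sub>R b"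
  shows "a = b"
proof -
  have "norm ((1 / (norm a)\<^sup>2) *\<^sub>R a) = 1 / norm a" "norm ((1 / (norm b)\<^sup>2) *\<^sub>R b) = 1 / norm b"
    using assms(1,2) by (simp_all add: power2_eq_square)
  then have "norm a = norm b" using eq by simp
  then show ?thesis using eq assms(1,2) by simp
qed

text \<open>
  Vanishing of the remainder at both points expresses the weak gradient in two ways. Where \<open>u \<noteq> 0\<close>, they would make
  the inversions of \<open>y - p\<close> and \<open>y - q\<close> equal.
\<close>

lemma hardy_equality_at_two_points_imp_zero:
  fixes u :: "'a::euclidean_space \<Rightarrow> real" and p q :: 'a
  assumes u: "u \<in> D12" and c: "c = (real DIM('a) - 2) / 2" "c > 0" and "p \<noteq> q"
    and p: "(\<integral>\<^sup>+y. ennreal (c\<^sup>2 * (u y)\<^sup>2 / (norm (y - p))\<^sup>2) \<partial>lebesgue)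
          = (\<integral>\<^sup>+y. ennreal ((norm (weak_gradient u y))\<^sup>2) \<partial>lebesgue)"
    and q: "(\<integral>\<^sup>+y. ennreal (c\<^sup>2 * (u y)\<^sup>2 / (norm (y - q))\<^sup>2) \<partial>lebesgue)
          = (\<integral>\<^sup>+y. ennreal ((norm (weak_gradient u y))\<^sup>2) \<partial>lebesgue)"
  shows "AE y in lebesgue. u y = 0"
proof -
  have "AE y in lebesgue. y \<noteq> p" "AE y in lebesgue. y \<noteq> q"
    by (rule AE_completion[OF AE_lborel_singleton])+
  with hardy_equality_at_point[OF u c(1) less_imp_le[OF c(2)] p]
    hardy_equality_at_point[OF u c(1) less_imp_le[OF c(2)] q]
  show ?thesis
  proof eventually_elim
    case (elim y)
    have "(c * u y / (norm (y - p))\<^sup>2) *\<^sub>R (y - p) = (c * u y / (norm (y - q))\<^sup>2) *\<^sub>R (y - q)"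
      using elim(1,2) by (metis add_left_cancel)
    then have "(c * u y) *\<^sub>R ((1 / (norm (y - p))\<^sup>2) *\<^sub>R (y - p)) = (c * u y) *\<^sub>R ((1 / (norm (y - q))\<^sup>2) *\<^sub>R (y - q))"
      by simp
    moreover have "(1 / (norm (y - p))\<^sup>2) *\<^sub>R (y - p) \<noteq> (1 / (norm (y - q))\<^sup>2) *\<^sub>R (y - q)"
      using inversion_injective[of "y - p" "y - q"] elim(3,4) \<open>p \<noteq> q\<close> by auto
    ultimately show ?case using c(2) by (metis scaleR_cancel_left mult_eq_0_iff less_irrefl)
  qed
qed

section \<open>The potential of the circle\<close>

lemma circle_param_eq:
  "circle_param r s = ((r * cos (s / r)) *\<^sub>R axis 1 1 + (r * sin (s / r)) *\<^sub>R axis 2 1, 0)"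
  by (auto simp: circle_param_def vec_eq_iff forall_2 axis_def)

lemma continuous_circle_param:
  "r > 0 \<Longrightarrow> continuous_on UNIV (circle_param r :: real \<Rightarrow> (real^2) \<times> (real^'m))"
  unfolding circle_param_eq by (intro continuous_intros) auto

lemma norm_circle_param: "r > 0 \<Longrightarrow> norm (circle_param r s :: (real^2) \<times> (real^'m)) = r"
  unfolding circle_param_def
  by (simp add: norm_Pair norm_eq_sqrt_inner inner_vec_def sum_2 flip: power2_eq_square)
    (simp add: power_mult_distrib flip: distrib_left)

lemma circle_param_in_circle: "r > 0 \<Longrightarrow> (circle_param r s :: (real^2) \<times> (real^'m)) \<in> circle r"
  using norm_circle_param[of r s, where 'm = 'm] by (auto simp: circle_def circle_param_def norm_Pair)

lemma closed_circle: "closed (circle r :: ((real^2) \<times> (real^'m)) set)"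
proof -
  have "circle r = {x :: (real^2) \<times> (real^'m). norm (fst x) = r} \<inter> {x. snd x = 0}"
    by (auto simp: circle_def)
  then show ?thesis
    by (auto intro!: closed_Int closed_Collect_eq continuous_intros)
qed

lemma AE_not_in_circle: "AE y in lebesgue. y \<notin> (circle r :: ((real^2) \<times> (real^'m)) set)"
proof -
  \<comment> \<open>The circle lies in a hyperplane because the second factor has positive dimension; any of its coordinates will do.\<close>
  let ?a = "(0, axis undefined 1) :: (real^2) \<times> (real^'m)"
  have "negligible {x. ?a \<bullet> x = 0}"
    by (rule negligible_hyperplane) (auto simp: zero_prod_def axis_eq_0_iff)
  then have "negligible (circle r :: ((real^2) \<times> (real^'m)) set)"
    by (rule negligible_subset) (auto simp: circle_def)
  then show ?thesis
    by (simp add: negligible_iff_null_sets AE_not_in)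
qed

lemma circle_potential_eq:
  assumes r: "r > 0"
  shows "circle_potential r y = (LINT s|lborel. indicator {0..<2 * pi * r} s *\<^sub>R
      (1 / (norm (circle_param r s - y :: (real^2) \<times> (real^'m)))\<^sup>2))"
proof -
  have [measurable]: "(circle_param r :: real \<Rightarrow> (real^2) \<times> (real^'m)) \<in> borel_measurable borel"
    by (rule borel_measurable_continuous_onI[OF continuous_circle_param[OF r]])
  have [measurable]: "(circle r :: ((real^2) \<times> (real^'m)) set) \<in> sets borel"
    by (rule borel_closed[OF closed_circle])
  have "circle_potential r y = (LINT s|restrict_space lborel {0..<2 * pi * r}.
      indicator (circle r) (circle_param r s :: (real^2) \<times> (real^'m)) *\<^sub>R (1 / (norm (circle_param r s - y))\<^sup>2))"
    unfolding circle_potential_def set_lebesgue_integral_def arc_length_def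
    by (subst integral_distr) (auto intro!: measurable_restrict_space1)
  also have "\<dots> = (LINT s|lborel. indicator {0..<2 * pi * r} s *\<^sub>R
      (indicator (circle r) (circle_param r s :: (real^2) \<times> (real^'m)) *\<^sub>R (1 / (norm (circle_param r s - y))\<^sup>2)))"
    by (rule integral_restrict_space) simp
  finally show ?thesis by (simp add: circle_param_in_circle[OF r])
qed

lemma circle_potential_nonneg: "r > 0 \<Longrightarrow> 0 \<le> circle_potential r y"
  unfolding circle_potential_eq by (rule integral_nonneg_AE) simp

lemma circle_potential_measurable:
  assumes r: "r > 0"
  shows "(circle_potential r :: (real^2) \<times> (real^'m) \<Rightarrow> real) \<in> borel_measurable borel"
proof -
  have [measurable]: "(circle_param r :: real \<Rightarrow> (real^2) \<times> (real^'m)) \<in> borel_measurable borel"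
    by (rule borel_measurable_continuous_onI[OF continuous_circle_param[OF r]])
  show ?thesis
    unfolding circle_potential_eq[OF r, abs_def] by measurable
qed

lemma circle_potential_integrable:
  fixes y :: "(real^2) \<times> (real^'m)"
  assumes r: "r > 0" and y: "y \<notin> circle r"
  shows "integrable lborel (\<lambda>s. indicator {0..<2 * pi * r} s *\<^sub>R (1 / (norm (circle_param r s - y))\<^sup>2))"
proof -
  have "set_integrable lborel {0..2 * pi * r} (\<lambda>s. 1 / (norm (circle_param r s - y))\<^sup>2)"
    unfolding set_integrable_def
  proof (rule borel_integrable_compact)
    have "circle_param r s \<noteq> y" for s using circle_param_in_circle[OF r] y by metis
    then show "continuous_on {0..2 * pi * r} (\<lambda>s. 1 / (norm (circle_param r s - y))\<^sup>2)"
      by (intro continuous_intros continuous_on_subset[OF continuous_circle_param[OF r]]) auto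
  qed simp
  then have "set_integrable lborel {0..<2 * pi * r} (\<lambda>s. 1 / (norm (circle_param r s - y))\<^sup>2)"
    by (rule set_integrable_subset) auto
  then show ?thesis by (simp add: set_integrable_def)
qed

text \<open>
  The potential is a Bochner integral with value 0 where it diverges. Off the circle, hence almost
  everywhere, it agrees with the nonnegative integral, to which Tonelli's theorem applies.
\<close>

lemma ennreal_circle_potential:
  fixes y :: "(real^2) \<times> (real^'m)"
  assumes r: "r > 0" and y: "y \<notin> circle r"
  shows "ennreal (circle_potential r y) =
      (\<integral>\<^sup>+s. indicator {0..<2 * pi * r} s * ennreal (1 / (norm (circle_param r s - y))\<^sup>2) \<partial>lborel)"
proof -
  have "ennreal (circle_potential r y) =
      (\<integral>\<^sup>+s. ennreal (indicator {0..<2 * pi * r} s *\<^sub>R (1 / (norm (circle_param r s - y))\<^sup>2)) \<partial>lborel)"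
    unfolding circle_potential_eq[OF r]
    by (rule nn_integral_eq_integral[symmetric, OF circle_potential_integrable[OF r y]]) simp
  also have "\<dots> = (\<integral>\<^sup>+s. indicator {0..<2 * pi * r} s * ennreal (1 / (norm (circle_param r s - y))\<^sup>2) \<partial>lborel)"
    by (rule nn_integral_cong) (simp add: indicator_def)
  finally show ?thesis .
qed

lemma circle_param_mean_zero:
  fixes y :: "(real^2) \<times> (real^'m)"
  assumes r: "r > 0"
  shows "has_bochner_integral lborel (\<lambda>s. indicator {0..<2 * pi * r} s *\<^sub>R (circle_param r s \<bullet> y)) 0"
proof -
  define F where "F s = r\<^sup>2 * sin (s / r) * (axis 1 1 \<bullet> fst y) - r\<^sup>2 * cos (s / r) * (axis 2 1 \<bullet> fst y)" for s
  have eq: "circle_param r s \<bullet> y = r * cos (s / r) * (axis 1 1 \<bullet> fst y) + r * sin (s / r) * (axis 2 1 \<bullet> fst y)" for s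
    unfolding circle_param_eq by (simp add: inner_prod_def inner_add_left)
  have "has_bochner_integral lborel (\<lambda>s. (circle_param r s \<bullet> y) * indicator {0..2 * pi * r} s) (F (2 * pi * r) - F 0)"
  proof (rule has_bochner_integral_FTC_Icc_real)
    show "DERIV F s :> circle_param r s \<bullet> y" for s
      unfolding F_def eq using r by (auto intro!: derivative_eq_intros simp: power2_eq_square)
    show "isCont (\<lambda>s. circle_param r s \<bullet> y) s" for s
      unfolding eq using r by (intro continuous_intros) auto
  qed (use r in simp)
  moreover have "F (2 * pi * r) - F 0 = 0" using r by (simp add: F_def)
  ultimately have "has_bochner_integral lborel (\<lambda>s. (circle_param r s \<bullet> y) * indicator {0..2 * pi * r} s) 0" by simp
  moreover have "AE s in lborel. (circle_param r s \<bullet> y) * indicator {0..2 * pi * r} s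
      = indicator {0..<2 * pi * r} s *\<^sub>R (circle_param r s \<bullet> y)"
    using AE_lborel_singleton[of "2 * pi * r"] by eventually_elim (auto simp: indicator_def)
  moreover have [measurable]: "(circle_param r :: real \<Rightarrow> (real^2) \<times> (real^'m)) \<in> borel_measurable borel"
    by (rule borel_measurable_continuous_onI[OF continuous_circle_param[OF r]])
  ultimately show ?thesis
    by (subst has_bochner_integral_cong_AE[where g = "\<lambda>s. (circle_param r s \<bullet> y) * indicator {0..2 * pi * r} s"])
       (measurable, auto)
qed

text \<open>
  Jensen's inequality for \<open>1 / t\<close>, by its tangent line \<open>2 / m - t / m\<^sup>2\<close> at the mean value \<open>m = r\<^sup>2 + |y|\<^sup>2\<close> of
  \<open>t = |x - y|\<^sup>2\<close>. The term of \<open>t\<close> that is linear in \<open>x\<close> has mean zero over the circle.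
\<close>

lemma circle_potential_lower_bound:
  fixes y :: "(real^2) \<times> (real^'m)"
  assumes r: "r > 0" and y: "y \<notin> circle r"
  shows "2 * pi * r / (r\<^sup>2 + (norm y)\<^sup>2) \<le> circle_potential r y"
proof -
  define m where "m = r\<^sup>2 + (norm y)\<^sup>2"
  have m: "m > 0" using r by (simp add: m_def add_pos_nonneg)
  let ?I = "\<lambda>s. indicator {0..<2 * pi * r} s :: real"
  have "has_bochner_integral lborel ?I (measure lborel {0..<2 * pi * r})"
    by (rule has_bochner_integral_real_indicator) (use r in simp_all)
  then have I: "has_bochner_integral lborel ?I (2 * pi * r)" using r by simp
  have "has_bochner_integral lborel
      (\<lambda>s. ?I s *\<^sub>R (1 / m) + 2 / m\<^sup>2 * (?I s *\<^sub>R (circle_param r s \<bullet> y))) ((2 * pi * r) *\<^sub>R (1 / m) + 2 / m\<^sup>2 * 0)"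
    by (intro has_bochner_integral_add has_bochner_integral_scaleR_left has_bochner_integral_mult_right
        I circle_param_mean_zero[OF r])
  then have *: "has_bochner_integral lborel
      (\<lambda>s. ?I s *\<^sub>R (1 / m) + 2 / m\<^sup>2 * (?I s *\<^sub>R (circle_param r s \<bullet> y))) (2 * pi * r / m)" by simp
  have "2 * pi * r / m = (LINT s|lborel. ?I s *\<^sub>R (1 / m) + 2 / m\<^sup>2 * (?I s *\<^sub>R (circle_param r s \<bullet> y)))"
    using has_bochner_integral_integral_eq[OF *] by simp
  also have "\<dots> \<le> circle_potential r y"
    unfolding circle_potential_eq[OF r]
  proof (rule integral_mono[OF _ circle_potential_integrable[OF r y]])
    show "integrable lborel (\<lambda>s. ?I s *\<^sub>R (1 / m) + 2 / m\<^sup>2 * (?I s *\<^sub>R (circle_param r s \<bullet> y)))"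
      using * by (rule integrable.intros)
    fix s
    define t where "t = (norm (circle_param r s - y))\<^sup>2"
    have "circle_param r s \<noteq> y" using circle_param_in_circle[OF r] y by metis
    then have t: "t > 0" by (simp add: t_def)
    have "t = m - 2 * (circle_param r s \<bullet> y)"
      unfolding t_def m_def power2_norm_eq_inner
      using norm_circle_param[OF r, of s, where 'm = 'm] power2_norm_eq_inner[of "circle_param r s :: (real^2) \<times> (real^'m)"]
      by (simp add: inner_diff_left inner_diff_right inner_commute)
    then have "1 / m + 2 / m\<^sup>2 * (circle_param r s \<bullet> y) = 2 / m - t / m\<^sup>2"
      using m by (simp add: field_simps power2_eq_square)
    also have "\<dots> \<le> 1 / t"
    proof -
      have "1 / t - (2 / m - t / m\<^sup>2) = (m - t)\<^sup>2 / (t * m\<^sup>2)"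
        using t m by (simp add: field_simps power2_eq_square)
      also have "\<dots> \<ge> 0" using t by simp
      finally show ?thesis by simp
    qed
    finally show "?I s *\<^sub>R (1 / m) + 2 / m\<^sup>2 * (?I s *\<^sub>R (circle_param r s \<bullet> y))
        \<le> ?I s *\<^sub>R (1 / (norm (circle_param r s - y))\<^sup>2)"
      by (simp add: t_def indicator_def)
  qed
  finally show ?thesis by (simp add: m_def)
qed

text \<open>
  Tonelli's theorem. The function \<open>u\<close> is replaced by a Borel function because the joint
  measurability that it requires is that of Borel sets.
\<close>

lemma nn_integral_circle_potential:
  fixes u :: "(real^2) \<times> (real^'m) \<Rightarrow> real"
  assumes r: "r > 0" and u: "u \<in> borel_measurable lebesgue"
  shows "(\<lambda>s. \<integral>\<^sup>+y. ennreal (k * (u y)\<^sup>2 / (norm (y - circle_param r s))\<^sup>2) \<partial>lebesgue) \<in> borel_measurable borel"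
    and "k \<ge> 0 \<Longrightarrow> (\<integral>\<^sup>+y. ennreal (k * (u y)\<^sup>2 * circle_potential r y) \<partial>lebesgue)
      = (\<integral>\<^sup>+s. indicator {0..<2 * pi * r} s *
          (\<integral>\<^sup>+y. ennreal (k * (u y)\<^sup>2 / (norm (y - circle_param r s))\<^sup>2) \<partial>lebesgue) \<partial>lborel)"
proof -
  have cm[measurable]: "(circle_param r :: real \<Rightarrow> (real^2) \<times> (real^'m)) \<in> borel_measurable borel"
    by (rule borel_measurable_continuous_onI[OF continuous_circle_param[OF r]])
  from completion_ex_borel_measurable_real[OF u]
  obtain v where vm: "v \<in> borel_measurable lborel" and ae: "AE x in lborel. u x = v x"
    by blast
  have [measurable]: "v \<in> borel_measurable borel" using vm by simp
  have inner: "(\<integral>\<^sup>+y. ennreal (k * (u y)\<^sup>2 / (norm (y - circle_param r s))\<^sup>2) \<partial>lebesgue)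
      = (\<integral>\<^sup>+y. ennreal (k * (v y)\<^sup>2 / (norm (y - circle_param r s))\<^sup>2) \<partial>lborel)" for s
    unfolding nn_integral_completion
    by (rule nn_integral_cong_AE) (use ae in eventually_elim, simp)
  show "(\<lambda>s. \<integral>\<^sup>+y. ennreal (k * (u y)\<^sup>2 / (norm (y - circle_param r s))\<^sup>2) \<partial>lebesgue) \<in> borel_measurable borel"
    unfolding inner by measurable
  assume k: "k \<ge> 0"
  have "AE y in lborel. y \<notin> (circle r :: ((real^2) \<times> (real^'m)) set)"
    using AE_not_in_circle[of r] by (simp add: AE_completion_iff)
  with ae have "AE y in lborel. ennreal (k * (u y)\<^sup>2 * circle_potential r y)
      = (\<integral>\<^sup>+s. indicator {0..<2 * pi * r} s * ennreal (k * (v y)\<^sup>2 / (norm (y - circle_param r s))\<^sup>2) \<partial>lborel)"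
  proof eventually_elim
    case (elim y)
    have "ennreal (k * (u y)\<^sup>2 * circle_potential r y) = ennreal (k * (v y)\<^sup>2) * ennreal (circle_potential r y)"
      using elim k circle_potential_nonneg[OF r, of y] ennreal_mult[of "k * (v y)\<^sup>2" "circle_potential r y"] by simp
    also have "\<dots> = (\<integral>\<^sup>+s. ennreal (k * (v y)\<^sup>2) *
        (indicator {0..<2 * pi * r} s * ennreal (1 / (norm (circle_param r s - y))\<^sup>2)) \<partial>lborel)"
      unfolding ennreal_circle_potential[OF r elim(2)] by (rule nn_integral_cmult[symmetric]) measurable
    also have "\<dots> = (\<integral>\<^sup>+s. indicator {0..<2 * pi * r} s * ennreal (k * (v y)\<^sup>2 / (norm (y - circle_param r s))\<^sup>2) \<partial>lborel)"
      using k by (intro nn_integral_cong) (auto simp: indicator_def norm_minus_commute simp flip: ennreal_mult)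
    finally show ?case .
  qed
  then have "(\<integral>\<^sup>+y. ennreal (k * (u y)\<^sup>2 * circle_potential r y) \<partial>lebesgue)
      = (\<integral>\<^sup>+y. (\<integral>\<^sup>+s. indicator {0..<2 * pi * r} s * ennreal (k * (v y)\<^sup>2 / (norm (y - circle_param r s))\<^sup>2) \<partial>lborel) \<partial>lborel)"
    unfolding nn_integral_completion by (rule nn_integral_cong_AE)
  also have "\<dots> = (\<integral>\<^sup>+s. (\<integral>\<^sup>+y. indicator {0..<2 * pi * r} s * ennreal (k * (v y)\<^sup>2 / (norm (y - circle_param r s))\<^sup>2) \<partial>lborel) \<partial>lborel)"
    by (rule lborel_pair.Fubini') measurable
  also have "\<dots> = (\<integral>\<^sup>+s. indicator {0..<2 * pi * r} s *
        (\<integral>\<^sup>+y. ennreal (k * (v y)\<^sup>2 / (norm (y - circle_param r s))\<^sup>2) \<partial>lborel) \<partial>lborel)"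
    by (intro nn_integral_cong nn_integral_cmult) measurable
  finally show "(\<integral>\<^sup>+y. ennreal (k * (u y)\<^sup>2 * circle_potential r y) \<partial>lebesgue)
      = (\<integral>\<^sup>+s. indicator {0..<2 * pi * r} s *
          (\<integral>\<^sup>+y. ennreal (k * (u y)\<^sup>2 / (norm (y - circle_param r s))\<^sup>2) \<partial>lebesgue) \<partial>lborel)"
    unfolding inner .
qed

section \<open>The averaged inequality\<close>

lemma AE_lborel_imp_ex:
  fixes a b :: real
  assumes "AE s in lborel. P s" "a < b"
  shows "\<exists>s\<in>{a..<b}. P s"
proof (rule ccontr)
  assume *: "\<not> ?thesis"
  obtain N where N: "{s \<in> space lborel. \<not> P s} \<subseteq> N" "emeasure lborel N = 0" "N \<in> sets lborel"
    using AE_E[OF assms(1)] by blast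
  have "emeasure lborel {a..<b} \<le> emeasure lborel N"
    by (rule emeasure_mono) (use * N in auto)
  then show False using N(2) assms(2) by simp
qed

text \<open>
  The deficit \<open>E - A s\<close> of Hardy's inequality at the point with parameter \<open>s\<close> is nonnegative. If its integral
  over the circle is zero, it vanishes for almost all parameters, so there is one such parameter in each half of the
  circle, and these give two different points.
\<close>

lemma circle_hardy_ennreal:
  fixes u :: "(real^2) \<times> (real^'m) \<Rightarrow> real"
  assumes u: "u \<in> D12" and r: "r > 0"
    and c: "c = (real DIM((real^2) \<times> (real^'m)) - 2) / 2" "c > 0"
  defines "E \<equiv> (\<integral>\<^sup>+y. ennreal ((norm (weak_gradient u y))\<^sup>2) \<partial>lebesgue)"
  shows circle_hardy_nn_le: "(\<integral>\<^sup>+y. ennreal (c\<^sup>2 * (u y)\<^sup>2 * circle_potential r y) \<partial>lebesgue) \<le> ennreal (2 * pi * r) * E"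
    and circle_hardy_nn_eq: "(\<integral>\<^sup>+y. ennreal (c\<^sup>2 * (u y)\<^sup>2 * circle_potential r y) \<partial>lebesgue) = ennreal (2 * pi * r) * E
      \<Longrightarrow> AE y in lebesgue. u y = 0"
proof -
  define A where "A s = (\<integral>\<^sup>+y. ennreal (c\<^sup>2 * (u y)\<^sup>2 / (norm (y - circle_param r s))\<^sup>2) \<partial>lebesgue)" for s
  note um = D12_measurable(1)[OF u]
  have [measurable]: "A \<in> borel_measurable borel"
    unfolding A_def by (rule nn_integral_circle_potential(1)[OF r um])
  have eq: "(\<integral>\<^sup>+y. ennreal (c\<^sup>2 * (u y)\<^sup>2 * circle_potential r y) \<partial>lebesgue)
      = (\<integral>\<^sup>+s. indicator {0..<2 * pi * r} s * A s \<partial>lborel)"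
    unfolding A_def by (rule nn_integral_circle_potential(2)[OF r um]) simp
  have A: "A s \<le> E" for s
    unfolding A_def E_def by (rule hardy_at_point[OF u c(1) less_imp_le[OF c(2)]])
  have const: "(\<integral>\<^sup>+s. indicator {0..<2 * pi * r} s * E \<partial>lborel) = ennreal (2 * pi * r) * E"
    using r by (subst nn_integral_multc) auto
  show "(\<integral>\<^sup>+y. ennreal (c\<^sup>2 * (u y)\<^sup>2 * circle_potential r y) \<partial>lebesgue) \<le> ennreal (2 * pi * r) * E"
    unfolding eq const[symmetric] by (intro nn_integral_mono mult_left_mono A) simp
  assume "(\<integral>\<^sup>+y. ennreal (c\<^sup>2 * (u y)\<^sup>2 * circle_potential r y) \<partial>lebesgue) = ennreal (2 * pi * r) * E"
  then have full: "(\<integral>\<^sup>+s. indicator {0..<2 * pi * r} s * A s \<partial>lborel) = ennreal (2 * pi * r) * E"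
    by (simp add: eq)
  have Efin: "E < \<infinity>" unfolding E_def by (rule D12_energy_finite[OF u])
  have "(\<integral>\<^sup>+s. indicator {0..<2 * pi * r} s * E - indicator {0..<2 * pi * r} s * A s \<partial>lborel)
      = (\<integral>\<^sup>+s. indicator {0..<2 * pi * r} s * E \<partial>lborel) - (\<integral>\<^sup>+s. indicator {0..<2 * pi * r} s * A s \<partial>lborel)"
  proof (rule nn_integral_diff)
    show "(\<integral>\<^sup>+s. indicator {0..<2 * pi * r} s * A s \<partial>lborel) \<noteq> \<infinity>"
      unfolding full using Efin by (simp add: ennreal_mult_eq_top_iff)
    show "AE s in lborel. indicator {0..<2 * pi * r} s * A s \<le> indicator {0..<2 * pi * r} s * E"
      by (intro AE_I2 mult_left_mono A) simp
  qed measurable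
  also have "\<dots> = 0" unfolding full const using Efin by (simp add: ennreal_mult_eq_top_iff)
  finally have "AE s in lborel. indicator {0..<2 * pi * r} s * E - indicator {0..<2 * pi * r} s * A s = 0"
    by (subst (asm) nn_integral_0_iff_AE) measurable
  then have ae: "AE s in lborel. s \<in> {0..<2 * pi * r} \<longrightarrow> A s = E"
  proof eventually_elim
    case (elim s)
    show ?case
    proof
      assume "s \<in> {0..<2 * pi * r}"
      with elim have "E - A s = 0" by simp
      then show "A s = E" using A[of s] Efin by (metis antisym diff_eq_0_iff_ennreal order.strict_iff_order top.not_eq_extremum)
    qed
  qed
  have pr: "0 < pi * r" "pi * r < 2 * pi * r" using r by simp_all
  obtain s where s: "s \<in> {0..<pi * r}" "A s = E"
    using AE_lborel_imp_ex[OF ae pr(1)] pr by auto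
  obtain t where t: "t \<in> {pi * r..<2 * pi * r}" "A t = E"
    using AE_lborel_imp_ex[OF ae pr(2)] pr by auto
  have "inj_on (circle_param r :: real \<Rightarrow> (real^2) \<times> (real^'m)) {0..<2 * pi * r}"
    using bij_betw_circle_param[OF r] by (rule bij_betw_imp_inj_on)
  then have "(circle_param r s :: (real^2) \<times> (real^'m)) \<noteq> circle_param r t"
    using s(1) t(1) pr by (auto dest: inj_onD)
  then show "AE y in lebesgue. u y = 0"
    by (rule hardy_equality_at_two_points_imp_zero[OF u c])
       (use s t in \<open>simp_all add: A_def E_def\<close>)
qed

section \<open>Optimality of the constant\<close>

text \<open>
  Near the origin the integrand is bounded, elsewhere it is at most \<open>|t|\<^sup>-\<^sup>2\<^sup>\<alpha>\<close>.
\<close>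

lemma nn_integral_rational_decay_real:
  fixes r \<alpha> :: real
  assumes r: "r > 0" and \<alpha>: "\<alpha> > 1 / 2"
  shows "(\<integral>\<^sup>+t. ennreal ((r\<^sup>2 + t\<^sup>2) powr - \<alpha>) \<partial>lborel) < \<infinity>"
proof -
  define g where "g t = (if t \<in> {1..} then t powr (- (2 * \<alpha>)) else 0)" for t :: real
  have [measurable]: "g \<in> borel_measurable borel" unfolding g_def by measurable
  have "((\<lambda>t. t powr (- (2 * \<alpha>))) has_integral - (1 powr (- (2 * \<alpha>) + 1)) / (- (2 * \<alpha>) + 1)) {1..}"
    by (rule has_integral_powr_to_inf) (use \<alpha> in auto)
  then have "(g has_integral - (1 powr (- (2 * \<alpha>) + 1)) / (- (2 * \<alpha>) + 1)) UNIV"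
    unfolding g_def by (rule has_integral_restrict_UNIV[THEN iffD2])
  then have "(\<integral>\<^sup>+t. ennreal (g t) \<partial>lborel) = ennreal (- (1 powr (- (2 * \<alpha>) + 1)) / (- (2 * \<alpha>) + 1))"
    by (rule nn_integral_has_integral_lborel[rotated 2]) (measurable, simp add: g_def)
  then have gfin: "(\<integral>\<^sup>+t. ennreal (g t) \<partial>lborel) < \<infinity>" by simp
  have grefl: "(\<integral>\<^sup>+t. ennreal (g (- t)) \<partial>lborel) = (\<integral>\<^sup>+t. ennreal (g t) \<partial>lborel)"
    using nn_integral_real_affine[of "\<lambda>t. ennreal (g t)" "-1" 0] by simp
  have decay: "(r\<^sup>2 + t\<^sup>2) powr - \<alpha> \<le> \<bar>t\<bar> powr (- (2 * \<alpha>))" if "\<bar>t\<bar> \<ge> 1" for t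
  proof -
    have "(r\<^sup>2 + t\<^sup>2) powr - \<alpha> \<le> (t\<^sup>2) powr - \<alpha>"
      by (rule powr_mono2') (use that \<alpha> in auto)
    also have "(t\<^sup>2) powr - \<alpha> = \<bar>t\<bar> powr (- (2 * \<alpha>))"
    proof -
      have "t\<^sup>2 = \<bar>t\<bar> powr 2" using that by (simp add: powr_numeral)
      then show ?thesis unfolding \<open>t\<^sup>2 = _\<close> powr_powr by simp
    qed
    finally show ?thesis .
  qed
  have le: "(r\<^sup>2 + t\<^sup>2) powr - \<alpha> \<le> (r\<^sup>2) powr - \<alpha> * indicator {-1..1} t + g t + g (- t)" for t
  proof -
    consider "\<bar>t\<bar> \<le> 1" | "t > 1" | "t < -1" by linarith
    then show ?thesis
    proof cases
      case 1
      have "(r\<^sup>2 + t\<^sup>2) powr - \<alpha> \<le> (r\<^sup>2) powr - \<alpha>"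
        by (rule powr_mono2') (use r \<alpha> in auto)
      moreover have "g t \<ge> 0" "g (- t) \<ge> 0" by (simp_all add: g_def)
      ultimately show ?thesis using 1 by (simp add: indicator_def abs_le_iff)
    qed (use decay[of t] in \<open>auto simp: g_def\<close>)
  qed
  have "(\<integral>\<^sup>+t. ennreal ((r\<^sup>2 + t\<^sup>2) powr - \<alpha>) \<partial>lborel)
      \<le> (\<integral>\<^sup>+t. ennreal ((r\<^sup>2) powr - \<alpha>) * indicator {-1..1} t + ennreal (g t) + ennreal (g (- t)) \<partial>lborel)"
  proof (rule nn_integral_mono)
    fix t
    have "ennreal ((r\<^sup>2 + t\<^sup>2) powr - \<alpha>) \<le> ennreal ((r\<^sup>2) powr - \<alpha> * indicator {-1..1} t + g t + g (- t))"
      by (rule ennreal_leI[OF le])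
    also have "\<dots> = ennreal ((r\<^sup>2) powr - \<alpha>) * indicator {-1..1} t + ennreal (g t) + ennreal (g (- t))"
      by (auto simp: g_def indicator_def ennreal_plus)
    finally show "ennreal ((r\<^sup>2 + t\<^sup>2) powr - \<alpha>)
        \<le> ennreal ((r\<^sup>2) powr - \<alpha>) * indicator {-1..1} t + ennreal (g t) + ennreal (g (- t))" .
  qed
  also have "\<dots> = (\<integral>\<^sup>+t. ennreal ((r\<^sup>2) powr - \<alpha>) * indicator {-1..1::real} t \<partial>lborel)
      + (\<integral>\<^sup>+t. ennreal (g t) \<partial>lborel) + (\<integral>\<^sup>+t. ennreal (g (- t)) \<partial>lborel)"
    by (simp add: nn_integral_add)
  also have "\<dots> < \<infinity>"
    unfolding grefl using gfin by (simp add: nn_integral_cmult_indicator ennreal_mult_less_top)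
  finally show ?thesis .
qed

text \<open>
  As \<open>r\<^sup>2 + |y|\<^sup>2\<close> dominates each \<open>r\<^sup>2 + y\<^sub>i\<^sup>2\<close>, it dominates their geometric mean. This bounds the
  integrand by a product of functions of one variable with exponent \<open>q / N > 1 / 2\<close>, whose integral is a product.
\<close>

lemma integrable_rational_decay:
  fixes r q :: real
  assumes r: "r > 0" and q: "q > real DIM('a) / 2"
  shows "integrable lborel (\<lambda>y::'a::euclidean_space. (r\<^sup>2 + (norm y)\<^sup>2) powr - q)"
proof -
  define N where "N = real DIM('a)"
  have N: "N > 0" by (simp add: N_def)
  define \<alpha> where "\<alpha> = q / N"
  have \<alpha>: "\<alpha> > 1 / 2" using q N by (simp add: \<alpha>_def N_def field_simps)
  have le: "(r\<^sup>2 + (norm y)\<^sup>2) powr - q \<le> (\<Prod>b\<in>Basis. (r\<^sup>2 + (y \<bullet> b)\<^sup>2) powr - \<alpha>)" for y :: 'a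
  proof -
    have m: "r\<^sup>2 + (norm y)\<^sup>2 > 0" using r by (simp add: add_pos_nonneg)
    have "(r\<^sup>2 + (norm y)\<^sup>2) powr - q = ((r\<^sup>2 + (norm y)\<^sup>2) powr - \<alpha>) powr N"
      using N by (simp add: powr_powr \<alpha>_def)
    also have "\<dots> = (\<Prod>b\<in>(Basis::'a set). (r\<^sup>2 + (norm y)\<^sup>2) powr - \<alpha>)"
    proof -
      have "(r\<^sup>2 + (norm y)\<^sup>2) powr - \<alpha> > 0" using m by (metis less_irrefl powr_gt_zero)
      from powr_realpow[OF this, of "DIM('a)"] show ?thesis by (simp add: N_def)
    qed
    also have "\<dots> \<le> (\<Prod>b\<in>Basis. (r\<^sup>2 + (y \<bullet> b)\<^sup>2) powr - \<alpha>)"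
    proof (rule prod_mono, safe)
      fix b :: 'a assume "b \<in> Basis"
      then have "(y \<bullet> b)\<^sup>2 \<le> (norm y)\<^sup>2"
        using Basis_le_norm[of b y] by (simp add: power2_le_iff_abs_le)
      then show "(r\<^sup>2 + (norm y)\<^sup>2) powr - \<alpha> \<le> (r\<^sup>2 + (y \<bullet> b)\<^sup>2) powr - \<alpha>"
        using r \<alpha> by (intro powr_mono2') (auto simp: add_pos_nonneg)
    qed simp
    finally show ?thesis .
  qed
  have "(\<integral>\<^sup>+y. ennreal ((r\<^sup>2 + (norm (y::'a))\<^sup>2) powr - q) \<partial>lborel)
      \<le> (\<integral>\<^sup>+y. (\<Prod>b\<in>(Basis::'a set). ennreal ((r\<^sup>2 + (y \<bullet> b)\<^sup>2) powr - \<alpha>)) \<partial>lborel)"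
    by (intro nn_integral_mono) (simp add: prod_ennreal ennreal_leI le)
  also have "\<dots> = (\<Prod>b\<in>(Basis::'a set). (\<integral>\<^sup>+t. ennreal ((r\<^sup>2 + t\<^sup>2) powr - \<alpha>) \<partial>lborel))"
    by (rule nn_integral_lborel_prod[where f = "\<lambda>_ t. ennreal ((r\<^sup>2 + t\<^sup>2) powr - \<alpha>)"]) auto
  also have "\<dots> < \<infinity>"
    using nn_integral_rational_decay_real[OF r \<alpha>] by (simp add: power_less_top_ennreal)
  finally show ?thesis
    by (intro integrableI_nonneg) auto
qed

text \<open>
  This function is the derivative of \<open>exp_bump 1\<close>; the bound serves to dominate the gradient of a cutoff
  built from \<open>exp_bump 1\<close>.
\<close>

lemma exp_bump_square_le: "exp_bump [:0, 0, 1:] t \<le> 2"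
proof (cases "t > 0")
  case True
  define s where "s = 1 / t"
  have s: "s \<ge> 0" using True by (simp add: s_def)
  have "s\<^sup>2 \<le> 2 * exp s" using exp_lower_Taylor_quadratic[OF s] s by simp
  then have "s\<^sup>2 * exp (- s) \<le> 2" by (simp add: exp_minus field_simps)
  then show ?thesis using True by (simp add: exp_bump_def s_def power2_eq_square)
qed (simp add: exp_bump_def)

lemma exp_bump_square_nonneg: "0 \<le> exp_bump [:0, 0, 1:] t"
  by (simp add: exp_bump_def)

text \<open>
  The test functions are \<open>(r\<^sup>2 + |y|\<^sup>2)\<^sup>-\<^sup>b\<^sup>/\<^sup>2\<close> with \<open>c < b < \<surd>C\<close>, multiplied by the smooth cutoff
  \<open>exp_bump 1 (1 - |y|\<^sup>2 / (n + 1)\<^sup>2)\<close>, which tends to the constant \<open>s = exp (- 1)\<close> as \<open>n\<close> grows. Both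
  integrals converge by dominated convergence, with limits at most \<open>b\<^sup>2 s\<^sup>2 J\<close> and equal to \<open>s\<^sup>2 J\<close>, where
  \<open>J\<close> is the integral of \<open>(r\<^sup>2 + |y|\<^sup>2)\<^sup>-\<^sup>b\<^sup>-\<^sup>1\<close>.
\<close>

lemma hardy_almost_optimal_test_function:
  fixes r C c :: real
  assumes r: "r > 0" and c: "c = (real DIM('a) - 2) / 2" "c \<ge> 0" and C: "C > c\<^sup>2"
  shows "\<exists>\<phi> :: 'a::euclidean_space \<Rightarrow> real. test_function \<phi> \<and>
    (LINT y|lborel. (norm (grad \<phi> y))\<^sup>2) < C * (LINT y|lborel. (\<phi> y)\<^sup>2 / (r\<^sup>2 + (norm y)\<^sup>2))"
proof -
  obtain b where b: "c < b" "b\<^sup>2 < C"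
  proof -
    have "c < sqrt C" using C c(2) by (simp add: real_less_rsqrt)
    then obtain b where "c < b" "b < sqrt C" using dense by blast
    moreover have "b\<^sup>2 < (sqrt C)\<^sup>2"
      using calculation c(2) by (intro power_strict_mono) auto
    moreover have "C \<ge> 0" using C zero_le_power2[of c] by linarith
    ultimately have "c < b" "b\<^sup>2 < C" by simp_all
    then show thesis by (rule that)
  qed
  have b0: "b > 0" using b c by simp
  define m where "m y = r\<^sup>2 + y \<bullet> y" for y :: 'a
  have m_norm: "m y = r\<^sup>2 + (norm y)\<^sup>2" for y by (simp add: m_def power2_norm_eq_inner)
  have m: "m y > 0" for y using r by (simp add: m_def add_pos_nonneg)
  define t where "t n y = 1 - y \<bullet> y / (real (Suc n))\<^sup>2" for n and y :: 'a
  define e1 e2 where "e1 = exp_bump 1" and "e2 = exp_bump [:0, 0, 1:]"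
  define \<phi> where "\<phi> n y = m y powr (- b / 2) * e1 (t n y)" for n y
  \<comment> \<open>The gradient of \<open>\<phi> n\<close> at \<open>y\<close> is \<open>- \<kappa> n y\<close> times \<open>y\<close>.\<close>
  define \<kappa> where "\<kappa> n y = b * m y powr (- b / 2 - 1) * e1 (t n y)
      + 2 / (real (Suc n))\<^sup>2 * m y powr (- b / 2) * e2 (t n y)" for n y
  define J where "J = (LINT y|lborel. m y powr (- b - 1))"
  have m_int: "integrable lborel (\<lambda>y. m y powr (- b - 1))"
    using integrable_rational_decay[OF r, of "b + 1", where 'a = 'a] b c by (simp add: m_norm)
  have [measurable]: "m \<in> borel_measurable borel" unfolding m_def by measurable
  have m_pow: "(m y powr (- b / 2))\<^sup>2 / m y = m y powr (- b - 1)"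
    "(m y powr (- b / 2 - 1))\<^sup>2 * m y = m y powr (- b - 1)"
    "m y powr (- b / 2) / m y = m y powr (- b / 2 - 1)" for y
  proof -
    have *: "(m y powr x)\<^sup>2 = m y powr (2 * x)" "m y powr x / m y = m y powr (x - 1)"
      "m y powr x * m y = m y powr (x + 1)" for x
      using m[of y] by (simp_all add: power2_eq_square powr_diff flip: powr_add)
         (simp add: powr_add)
    show "(m y powr (- b / 2))\<^sup>2 / m y = m y powr (- b - 1)"
      "(m y powr (- b / 2 - 1))\<^sup>2 * m y = m y powr (- b - 1)"
      "m y powr (- b / 2) / m y = m y powr (- b / 2 - 1)"
      unfolding * by (rule arg_cong[where f = "\<lambda>x. m y powr x"], simp)+
  qed
  have norm_m: "(norm y)\<^sup>2 \<le> m y" for y by (simp add: m_norm)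
  have supp: "norm y < real (Suc n)" if "t n y > 0" for n y
  proof -
    have "(norm y)\<^sup>2 < (real (Suc n))\<^sup>2"
      using that by (simp add: t_def power2_norm_eq_inner field_simps del: of_nat_Suc)
    then show ?thesis by (rule power_less_imp_less_base) simp
  qed
  have Ck_m: "Ck k m" for k
    unfolding m_def using Ck_add[OF Ck_const Ck_inner_diff_self[of k 0]] by simp
  have Ck_t: "Ck k (t n)" for k n
    unfolding t_def using Ck_diff[OF Ck_const Ck_mult[OF Ck_inner_diff_self[of k 0] Ck_const[of k "1 / (real (Suc n))\<^sup>2"]], of 1]
    by simp
  have test: "test_function (\<phi> n)" for n
    unfolding test_function_iff
  proof (intro conjI allI)
    show "Ck k (\<phi> n)" for k
      unfolding \<phi>_def e1_def by (rule Ck_mult[OF Ck_powr[OF m Ck_m] Ck_exp_bump[OF Ck_t]])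
    show "bounded {x. \<phi> n x \<noteq> 0}"
      by (rule bounded_subset[OF bounded_ball[of 0 "real (Suc n)"]])
         (use supp in \<open>auto simp: \<phi>_def e1_def exp_bump_one split: if_splits\<close>)
  qed
  have grad: "grad (\<phi> n) y = - \<kappa> n y *\<^sub>R y" for n y
  proof (rule grad_eqI)
    have dm: "(m has_derivative (\<lambda>h. 2 * (y \<bullet> h))) (at y)"
      unfolding m_def by (auto intro!: derivative_eq_intros simp: inner_commute)
    have dt: "(t n has_derivative (\<lambda>h. - 2 * (y \<bullet> h) / (real (Suc n))\<^sup>2)) (at y)"
    proof -
      define K where "K = 1 / (real (Suc n))\<^sup>2"
      have "t n = (\<lambda>y. 1 - K * (y \<bullet> y))" by (simp add: t_def K_def fun_eq_iff)
      moreover have "((\<lambda>y. 1 - K * (y \<bullet> y)) has_derivative (\<lambda>h. - 2 * (y \<bullet> h) * K)) (at y)"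
        by (auto intro!: derivative_eq_intros simp: inner_commute)
      ultimately show ?thesis by (simp add: K_def)
    qed
    have "((\<lambda>x. x powr (- b / 2)) has_derivative (*) ((- b / 2) * m y powr (- b / 2 - 1))) (at (m y))"
      using has_real_derivative_powr[OF m[of y], of "- b / 2"] unfolding has_field_derivative_def .
    from has_derivative_compose[OF dm this]
    have 1: "((\<lambda>y. m y powr (- b / 2)) has_derivative (\<lambda>h. (- b / 2) * m y powr (- b / 2 - 1) * (2 * (y \<bullet> h)))) (at y)" .
    have "(e1 has_derivative (*) (e2 (t n y))) (at (t n y))"
      using exp_bump_has_derivative[of 1 "t n y"] unfolding e1_def e2_def
      by (simp add: has_field_derivative_def)
    from has_derivative_compose[OF dt this]
    have 2: "((\<lambda>y. e1 (t n y)) has_derivative (\<lambda>h. e2 (t n y) * (- 2 * (y \<bullet> h) / (real (Suc n))\<^sup>2))) (at y)" .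
    show "(\<phi> n has_derivative (\<lambda>h. (- \<kappa> n y *\<^sub>R y) \<bullet> h)) (at y)"
      unfolding \<phi>_def
      by (rule has_derivative_eq_rhs[OF has_derivative_mult[OF 1 2]])
         (simp add: \<kappa>_def fun_eq_iff algebra_simps del: of_nat_Suc)
  qed
  have e1: "0 \<le> e1 x" "e1 x \<le> 1" for x unfolding e1_def by (rule exp_bump_one_bounds)+
  have e2: "0 \<le> e2 x" "e2 x \<le> 2" for x
    unfolding e2_def by (rule exp_bump_square_nonneg exp_bump_square_le)+
  define B where "B = b + 4 * (r\<^sup>2 + 1)"
  have \<kappa>_bound: "0 \<le> \<kappa> n y" "\<kappa> n y \<le> B * m y powr (- b / 2 - 1)" for n y
  proof -
    show "0 \<le> \<kappa> n y" using b0 e1 e2 by (simp add: \<kappa>_def)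
    \<comment> \<open>On the support of the cutoff \<open>|y|\<close> is less than \<open>n + 1\<close>, so that \<open>1 / (n + 1)\<^sup>2\<close> is at most a constant over \<open>m y\<close>.\<close>
    have "2 / (real (Suc n))\<^sup>2 * m y powr (- b / 2) * e2 (t n y) \<le> 4 * (r\<^sup>2 + 1) * m y powr (- b / 2 - 1)"
    proof (cases "t n y > 0")
      case True
      have k: "(real (Suc n))\<^sup>2 \<ge> 1" by (simp add: one_le_power del: of_nat_Suc)
      have "(norm y)\<^sup>2 \<le> (real (Suc n))\<^sup>2" using supp[OF True] by (intro power_mono) auto
      moreover have "r\<^sup>2 \<le> r\<^sup>2 * (real (Suc n))\<^sup>2" using k by (simp add: mult_left_le_one_le mult_le_cancel_left1 del: of_nat_Suc)
      ultimately have "m y \<le> (r\<^sup>2 + 1) * (real (Suc n))\<^sup>2" unfolding m_norm distrib_right by linarith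
      then have "1 / (real (Suc n))\<^sup>2 \<le> (r\<^sup>2 + 1) / m y"
        using m[of y] by (simp add: field_simps del: of_nat_Suc)
      then have "1 / (real (Suc n))\<^sup>2 * (2 * m y powr (- b / 2) * e2 (t n y)) \<le> (r\<^sup>2 + 1) / m y * (2 * m y powr (- b / 2) * 2)"
        using e2 m[of y] by (intro mult_mono) (auto simp: less_imp_le)
      also have "\<dots> = 4 * (r\<^sup>2 + 1) * (m y powr (- b / 2) / m y)" by simp
      finally show ?thesis unfolding m_pow by (simp add: mult_ac)
    next
      case False
      then show ?thesis by (simp add: e2_def exp_bump_def)
    qed
    moreover have "b * m y powr (- b / 2 - 1) * e1 (t n y) \<le> b * m y powr (- b / 2 - 1)"
      using b0 e1[of "t n y"] by (simp add: mult_left_le)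
    ultimately show "\<kappa> n y \<le> B * m y powr (- b / 2 - 1)"
      unfolding \<kappa>_def B_def distrib_right by linarith
  qed
  have n_lim: "(\<lambda>n. 1 / (real (Suc n))\<^sup>2) \<longlonglongrightarrow> 0"
    using tendsto_power[OF LIMSEQ_Suc[OF lim_1_over_n], of 2] by (simp add: power_divide)
  have t_lim: "(\<lambda>n. t n y) \<longlonglongrightarrow> 1" for y
    using tendsto_diff[OF tendsto_const[of 1] tendsto_mult[OF tendsto_const[of "y \<bullet> y"] n_lim]] by (simp add: t_def)
  have e_lim: "(\<lambda>n. exp_bump p (t n y)) \<longlonglongrightarrow> exp_bump p 1" for p y
    by (rule isCont_tendsto_compose[OF DERIV_isCont[OF exp_bump_has_derivative] t_lim])
  define s where "s = exp (-1 :: real)"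
  have s: "s > 0" by (simp add: s_def)
  have e1_lim: "(\<lambda>n. e1 (t n y)) \<longlonglongrightarrow> s" for y
    using e_lim[of 1 y] by (simp add: e1_def s_def exp_bump_one)
  have e2_lim: "(\<lambda>n. e2 (t n y)) \<longlonglongrightarrow> e2 1" for y
    unfolding e2_def by (rule e_lim)
  have e_meas[measurable]: "exp_bump p \<in> borel_measurable borel" for p
    by (intro borel_measurable_continuous_onI continuous_at_imp_continuous_on ballI DERIV_isCont[OF exp_bump_has_derivative])
  have [measurable]: "t n \<in> borel_measurable borel" for n unfolding t_def by measurable
  have [measurable]: "e1 \<in> borel_measurable borel" "e2 \<in> borel_measurable borel" unfolding e1_def e2_def by measurable
  have [measurable]: "\<phi> n \<in> borel_measurable borel" "\<kappa> n \<in> borel_measurable borel" for n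
    unfolding \<phi>_def \<kappa>_def by measurable
  have lim_E: "(\<lambda>n. LINT y|lborel. (\<kappa> n y)\<^sup>2 * (norm y)\<^sup>2)
      \<longlonglongrightarrow> (LINT y|lborel. (b * m y powr (- b / 2 - 1) * s)\<^sup>2 * (norm y)\<^sup>2)"
  proof (rule integral_dominated_convergence)
    show "integrable lborel (\<lambda>y. B\<^sup>2 * m y powr (- b - 1))" using m_int by simp
    show "AE y in lborel. (\<lambda>n. (\<kappa> n y)\<^sup>2 * (norm y)\<^sup>2) \<longlonglongrightarrow> (b * m y powr (- b / 2 - 1) * s)\<^sup>2 * (norm y)\<^sup>2"
    proof (intro AE_I2 tendsto_mult tendsto_power tendsto_const)
      fix y
      have "(\<lambda>n. b * m y powr (- b / 2 - 1) * e1 (t n y) + 2 * (1 / (real (Suc n))\<^sup>2) * m y powr (- b / 2) * e2 (t n y))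
          \<longlonglongrightarrow> b * m y powr (- b / 2 - 1) * s + 2 * 0 * m y powr (- b / 2) * e2 1"
        by (intro tendsto_add tendsto_mult tendsto_const e1_lim e2_lim n_lim)
      then show "(\<lambda>n. \<kappa> n y) \<longlonglongrightarrow> b * m y powr (- b / 2 - 1) * s" by (simp add: \<kappa>_def)
    qed
    show "AE y in lborel. norm ((\<kappa> n y)\<^sup>2 * (norm y)\<^sup>2) \<le> B\<^sup>2 * m y powr (- b - 1)" for n
    proof (rule AE_I2)
      fix y
      have "(\<kappa> n y)\<^sup>2 * (norm y)\<^sup>2 \<le> (B * m y powr (- b / 2 - 1))\<^sup>2 * m y"
        by (intro mult_mono power_mono \<kappa>_bound norm_m) auto
      also have "\<dots> = B\<^sup>2 * ((m y powr (- b / 2 - 1))\<^sup>2 * m y)" by (simp add: power_mult_distrib)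
      finally show "norm ((\<kappa> n y)\<^sup>2 * (norm y)\<^sup>2) \<le> B\<^sup>2 * m y powr (- b - 1)" unfolding m_pow by simp
    qed
  qed measurable
  have E_le: "(LINT y|lborel. (b * m y powr (- b / 2 - 1) * s)\<^sup>2 * (norm y)\<^sup>2) \<le> b\<^sup>2 * s\<^sup>2 * J"
  proof -
    have le: "(b * m y powr (- b / 2 - 1) * s)\<^sup>2 * (norm y)\<^sup>2 \<le> b\<^sup>2 * s\<^sup>2 * m y powr (- b - 1)" for y
    proof -
      have "(b * m y powr (- b / 2 - 1) * s)\<^sup>2 * (norm y)\<^sup>2 \<le> (b * m y powr (- b / 2 - 1) * s)\<^sup>2 * m y"
        by (intro mult_left_mono norm_m) simp
      also have "\<dots> = b\<^sup>2 * s\<^sup>2 * ((m y powr (- b / 2 - 1))\<^sup>2 * m y)" by (simp add: power_mult_distrib mult_ac)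
      finally show ?thesis unfolding m_pow .
    qed
    have i: "integrable lborel (\<lambda>y. b\<^sup>2 * s\<^sup>2 * m y powr (- b - 1))" using m_int by simp
    have "integrable lborel (\<lambda>y. (b * m y powr (- b / 2 - 1) * s)\<^sup>2 * (norm y)\<^sup>2)"
      by (rule Bochner_Integration.integrable_bound[OF i]) (use le in \<open>auto intro!: AE_I2\<close>)
    then have "(LINT y|lborel. (b * m y powr (- b / 2 - 1) * s)\<^sup>2 * (norm y)\<^sup>2) \<le> (LINT y|lborel. b\<^sup>2 * s\<^sup>2 * m y powr (- b - 1))"
      by (rule integral_mono[OF _ i le])
    then show ?thesis by (simp add: J_def)
  qed
  have lim_P: "(\<lambda>n. LINT y|lborel. (\<phi> n y)\<^sup>2 / m y) \<longlonglongrightarrow> (LINT y|lborel. s\<^sup>2 * m y powr (- b - 1))"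
  proof (rule integral_dominated_convergence[OF _ _ m_int])
    have eq: "(\<phi> n y)\<^sup>2 / m y = (e1 (t n y))\<^sup>2 * m y powr (- b - 1)" for n y
      unfolding \<phi>_def m_pow(1)[symmetric] by (simp add: power_mult_distrib)
    show "AE y in lborel. (\<lambda>n. (\<phi> n y)\<^sup>2 / m y) \<longlonglongrightarrow> s\<^sup>2 * m y powr (- b - 1)"
      unfolding eq by (intro AE_I2 tendsto_mult tendsto_power e1_lim tendsto_const)
    show "AE y in lborel. norm ((\<phi> n y)\<^sup>2 / m y) \<le> m y powr (- b - 1)" for n
      unfolding eq using e1 by (intro AE_I2) (simp add: mult_left_le_one_le power_le_one)
  qed measurable
  have J: "J > 0"
  proof -
    have "J \<ge> 0" unfolding J_def by (rule integral_nonneg_AE) simp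
    moreover have "J \<noteq> 0"
    proof
      assume "J = 0"
      then have "AE y in lborel. m y powr (- b - 1) = 0"
        unfolding J_def by (subst (asm) integral_nonneg_eq_0_iff_AE[OF m_int]) auto
      then have "AE y::'a in lborel. False"
      proof (rule eventually_mono)
        show False if "m y powr (- b - 1) = 0" for y using that m[of y] by simp
      qed
      then have "emeasure lborel (UNIV :: 'a set) = 0" by (simp add: AE_iff_measurable[OF _ refl])
      then show False by simp
    qed
    ultimately show ?thesis by simp
  qed
  have "b\<^sup>2 * s\<^sup>2 * J < C * (s\<^sup>2 * J)" using b J s by simp
  then have "(LINT y|lborel. (b * m y powr (- b / 2 - 1) * s)\<^sup>2 * (norm y)\<^sup>2) < C * (LINT y|lborel. s\<^sup>2 * m y powr (- b - 1))"
    using E_le by (simp add: J_def)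
  then have "\<forall>\<^sub>F n in sequentially.
      0 < C * (LINT y|lborel. (\<phi> n y)\<^sup>2 / m y) - (LINT y|lborel. (\<kappa> n y)\<^sup>2 * (norm y)\<^sup>2)"
    by (intro order_tendstoD(1)[OF tendsto_diff[OF tendsto_mult[OF tendsto_const lim_P] lim_E]]) simp
  then obtain n where "0 < C * (LINT y|lborel. (\<phi> n y)\<^sup>2 / m y) - (LINT y|lborel. (\<kappa> n y)\<^sup>2 * (norm y)\<^sup>2)"
    by (meson eventually_happens' sequentially_bot)
  then have n: "(LINT y|lborel. (\<kappa> n y)\<^sup>2 * (norm y)\<^sup>2) < C * (LINT y|lborel. (\<phi> n y)\<^sup>2 / m y)" by simp
  have "(norm (grad (\<phi> n) y))\<^sup>2 = (\<kappa> n y)\<^sup>2 * (norm y)\<^sup>2" for y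
    by (simp add: grad power_mult_distrib)
  with n show ?thesis
    by (intro exI[of _ "\<phi> n"]) (simp add: test m_norm)
qed

lemma D12_circle_hardy_integrals:
  fixes u :: "(real^2) \<times> (real^'m) \<Rightarrow> real"
  assumes u: "u \<in> D12" and r: "r > 0"
    and c: "c = (real DIM((real^2) \<times> (real^'m)) - 2) / 2" "c > 0"
  shows D12_circle_potential_integrable: "integrable lebesgue (\<lambda>y. (u y)\<^sup>2 * circle_potential r y)"
    and circle_hardy: "c\<^sup>2 * (LINT y|lebesgue. (u y)\<^sup>2 * circle_potential r y)
      \<le> 2 * pi * r * (LINT y|lebesgue. (norm (weak_gradient u y))\<^sup>2)"
    and circle_hardy_strict: "c\<^sup>2 * (LINT y|lebesgue. (u y)\<^sup>2 * circle_potential r y)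
      = 2 * pi * r * (LINT y|lebesgue. (norm (weak_gradient u y))\<^sup>2) \<Longrightarrow> AE y in lebesgue. u y = 0"
proof -
  note [measurable] = D12_measurable[OF u]
  have [measurable]: "(circle_potential r :: (real^2) \<times> (real^'m) \<Rightarrow> real) \<in> borel_measurable lebesgue"
    by (rule measurable_completion) (simp add: circle_potential_measurable[OF r])
  have V: "0 \<le> circle_potential r y" for y :: "(real^2) \<times> (real^'m)"
    by (rule circle_potential_nonneg[OF r])
  have Efin: "(\<integral>\<^sup>+y. ennreal ((norm (weak_gradient u y))\<^sup>2) \<partial>lebesgue) < \<infinity>"
    by (rule D12_energy_finite[OF u])
  have iE: "integrable lebesgue (\<lambda>y. (norm (weak_gradient u y))\<^sup>2)"
    by (rule integrableI_nonneg) (use Efin in auto)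
  have "(\<integral>\<^sup>+y. ennreal (c\<^sup>2 * (u y)\<^sup>2 * circle_potential r y) \<partial>lebesgue) < \<infinity>"
    by (rule le_less_trans[OF circle_hardy_nn_le[OF u r c]])
       (use Efin in \<open>simp add: ennreal_mult_less_top\<close>)
  then have "integrable lebesgue (\<lambda>y. c\<^sup>2 * (u y)\<^sup>2 * circle_potential r y)"
    by (intro integrableI_nonneg) (auto simp: V)
  then have iP': "integrable lebesgue (\<lambda>y. c\<^sup>2 * ((u y)\<^sup>2 * circle_potential r y))" by (simp add: mult.assoc)
  then show iP: "integrable lebesgue (\<lambda>y. (u y)\<^sup>2 * circle_potential r y)"
    using c(2) by simp
  define P where "P = (LINT y|lebesgue. (u y)\<^sup>2 * circle_potential r y)"
  define D where "D = (LINT y|lebesgue. (norm (weak_gradient u y))\<^sup>2)"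
  have "P \<ge> 0" unfolding P_def by (rule integral_nonneg_AE) (simp add: V)
  have "D \<ge> 0" unfolding D_def by (rule integral_nonneg_AE) simp
  have nP: "(\<integral>\<^sup>+y. ennreal (c\<^sup>2 * (u y)\<^sup>2 * circle_potential r y) \<partial>lebesgue) = ennreal (c\<^sup>2 * P)"
    using nn_integral_eq_integral[OF iP'] V by (simp add: P_def mult.assoc)
  have nE: "ennreal (2 * pi * r) * (\<integral>\<^sup>+y. ennreal ((norm (weak_gradient u y))\<^sup>2) \<partial>lebesgue) = ennreal (2 * pi * r * D)"
    using nn_integral_eq_integral[OF iE] r \<open>D \<ge> 0\<close> by (simp add: D_def ennreal_mult)
  show "c\<^sup>2 * (LINT y|lebesgue. (u y)\<^sup>2 * circle_potential r y)
      \<le> 2 * pi * r * (LINT y|lebesgue. (norm (weak_gradient u y))\<^sup>2)"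
    using circle_hardy_nn_le[OF u r c] r \<open>D \<ge> 0\<close> unfolding nP nE
    by (simp add: P_def D_def ennreal_le_iff)
  show "AE y in lebesgue. u y = 0" if "c\<^sup>2 * (LINT y|lebesgue. (u y)\<^sup>2 * circle_potential r y)
      = 2 * pi * r * (LINT y|lebesgue. (norm (weak_gradient u y))\<^sup>2)"
    by (rule circle_hardy_nn_eq[OF u r c], unfold nP nE) (use that in \<open>simp add: P_def D_def\<close>)
qed

theorem theorem1p1:
  fixes r :: real and N :: nat
  assumes "N = DIM((real^2) \<times> (real^'m))" and "N \<ge> 3" and "r > 0"
  shows "(\<forall>u \<in> (D12 :: ((real^2) \<times> (real^'m) \<Rightarrow> real) set).
            (\<lambda>y. u y * sqrt (circle_potential r y)) \<in> L2 \<and>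
            ((real N - 2) / 2)\<^sup>2 *
                (LINT y|lebesgue. \<bar>u y\<bar>\<^sup>2 * (1 / (2 * pi * r) * circle_potential r y))
              \<le> (LINT y|lebesgue. (norm (weak_gradient u y))\<^sup>2))
       \<and> (\<forall>C > ((real N - 2) / 2)\<^sup>2. \<exists>u \<in> (D12 :: ((real^2) \<times> (real^'m) \<Rightarrow> real) set).
            C * (LINT y|lebesgue. \<bar>u y\<bar>\<^sup>2 * (1 / (2 * pi * r) * circle_potential r y))
              > (LINT y|lebesgue. (norm (weak_gradient u y))\<^sup>2))
       \<and> (\<forall>u \<in> (D12 :: ((real^2) \<times> (real^'m) \<Rightarrow> real) set).
            \<not> (AE y in lebesgue. u y = 0) \<longrightarrow>
            ((real N - 2) / 2)\<^sup>2 *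
                (LINT y|lebesgue. \<bar>u y\<bar>\<^sup>2 * (1 / (2 * pi * r) * circle_potential r y))
              \<noteq> (LINT y|lebesgue. (norm (weak_gradient u y))\<^sup>2))"
proof -
  define c where "c = (real N - 2) / 2"
  have c: "c = (real DIM((real^2) \<times> (real^'m)) - 2) / 2" "c > 0"
    using assms(1,2) by (simp_all add: c_def)
  note r = \<open>r > 0\<close>
  have P: "(LINT y|lebesgue. \<bar>u y\<bar>\<^sup>2 * (1 / (2 * pi * r) * circle_potential r y))
      = (LINT y|lebesgue. (u y)\<^sup>2 * circle_potential r y) / (2 * pi * r)" for u :: "(real^2) \<times> (real^'m) \<Rightarrow> real"
    by simp
  have V: "0 \<le> circle_potential r y" for y :: "(real^2) \<times> (real^'m)"
    by (rule circle_potential_nonneg[OF r])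
  have [measurable]: "(circle_potential r :: (real^2) \<times> (real^'m) \<Rightarrow> real) \<in> borel_measurable lebesgue"
    by (rule measurable_completion) (simp add: circle_potential_measurable[OF r])
  have L2: "(\<lambda>y. u y * sqrt (circle_potential r y)) \<in> L2" if u: "u \<in> D12" for u :: "(real^2) \<times> (real^'m) \<Rightarrow> real"
  proof -
    note [measurable] = D12_measurable[OF u]
    show ?thesis
      using D12_circle_potential_integrable[OF u r c] by (simp add: L2_def power_mult_distrib V)
  qed
  have ineq: "c\<^sup>2 * (LINT y|lebesgue. \<bar>u y\<bar>\<^sup>2 * (1 / (2 * pi * r) * circle_potential r y))
      \<le> (LINT y|lebesgue. (norm (weak_gradient u y))\<^sup>2)" if u: "u \<in> D12" for u :: "(real^2) \<times> (real^'m) \<Rightarrow> real"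
    using circle_hardy[OF u r c] r unfolding P by (simp add: field_simps)
  have strict: "AE y in lebesgue. u y = 0"
    if u: "u \<in> D12" and eq: "c\<^sup>2 * (LINT y|lebesgue. \<bar>u y\<bar>\<^sup>2 * (1 / (2 * pi * r) * circle_potential r y))
      = (LINT y|lebesgue. (norm (weak_gradient u y))\<^sup>2)" for u :: "(real^2) \<times> (real^'m) \<Rightarrow> real"
    by (rule circle_hardy_strict[OF u r c]) (use eq r in \<open>simp add: P field_simps\<close>)
  have opt: "\<exists>u \<in> (D12 :: ((real^2) \<times> (real^'m) \<Rightarrow> real) set).
      C * (LINT y|lebesgue. \<bar>u y\<bar>\<^sup>2 * (1 / (2 * pi * r) * circle_potential r y))
        > (LINT y|lebesgue. (norm (weak_gradient u y))\<^sup>2)" if C: "C > c\<^sup>2" for C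
  proof -
    obtain \<phi> :: "(real^2) \<times> (real^'m) \<Rightarrow> real" where \<phi>: "test_function \<phi>"
      and less: "(LINT y|lborel. (norm (grad \<phi> y))\<^sup>2) < C * (LINT y|lborel. (\<phi> y)\<^sup>2 / (r\<^sup>2 + (norm y)\<^sup>2))"
      using hardy_almost_optimal_test_function[OF r c(1) less_imp_le[OF c(2)] C] by blast
    have D: "\<phi> \<in> D12" by (rule test_function_in_D12[OF \<phi>])
    have Ck: "Ck (Suc 0) \<phi>" "bounded {x. \<phi> x \<noteq> 0}" using \<phi> unfolding test_function_iff by blast+
    have [measurable]: "\<phi> \<in> borel_measurable borel" "grad \<phi> \<in> borel_measurable borel"
      using Ck_continuous[OF Ck(1)] continuous_grad[OF Ck(1)] by (auto simp: borel_measurable_continuous_onI)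
    have "(LINT y|lebesgue. (norm (weak_gradient \<phi> y))\<^sup>2) = (LINT y|lebesgue. (norm (grad \<phi> y))\<^sup>2)"
    proof (rule integral_cong_AE)
      have "grad \<phi> \<in> borel_measurable lebesgue" by (rule measurable_completion) simp
      then show "(\<lambda>y. (norm (grad \<phi> y))\<^sup>2) \<in> borel_measurable lebesgue" by measurable
      show "(\<lambda>y. (norm (weak_gradient \<phi> y))\<^sup>2) \<in> borel_measurable lebesgue"
        using D12_measurable(2)[OF D] by measurable
      show "AE y in lebesgue. (norm (weak_gradient \<phi> y))\<^sup>2 = (norm (grad \<phi> y))\<^sup>2"
        using weak_gradient_AE[OF test_function_has_weak_gradient[OF \<phi>]] by eventually_elim simp
    qed
    also have "\<dots> = (LINT y|lborel. (norm (grad \<phi> y))\<^sup>2)" by (rule integral_completion) measurable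
    also note less
    also have "(LINT y|lborel. (\<phi> y)\<^sup>2 / (r\<^sup>2 + (norm y)\<^sup>2)) = (LINT y|lebesgue. (\<phi> y)\<^sup>2 / (r\<^sup>2 + (norm y)\<^sup>2))"
      by (rule integral_completion[symmetric]) measurable
    also have "C * \<dots> \<le> C * (LINT y|lebesgue. \<bar>\<phi> y\<bar>\<^sup>2 * (1 / (2 * pi * r) * circle_potential r y))"
    proof (rule mult_left_mono)
      show "0 \<le> C" using C by (meson less_imp_le order_trans zero_le_power2)
      show "(LINT y|lebesgue. (\<phi> y)\<^sup>2 / (r\<^sup>2 + (norm y)\<^sup>2))
          \<le> (LINT y|lebesgue. \<bar>\<phi> y\<bar>\<^sup>2 * (1 / (2 * pi * r) * circle_potential r y))"
      proof (rule integral_mono_AE')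
        show "integrable lebesgue (\<lambda>y. \<bar>\<phi> y\<bar>\<^sup>2 * (1 / (2 * pi * r) * circle_potential r y))"
          using D12_circle_potential_integrable[OF D r c] by simp
        show "AE y in lebesgue. (\<phi> y)\<^sup>2 / (r\<^sup>2 + (norm y)\<^sup>2) \<le> \<bar>\<phi> y\<bar>\<^sup>2 * (1 / (2 * pi * r) * circle_potential r y)"
          using AE_not_in_circle[of r]
        proof eventually_elim
          case (elim y)
          have "1 / (r\<^sup>2 + (norm y)\<^sup>2) \<le> 1 / (2 * pi * r) * circle_potential r y"
            using circle_potential_lower_bound[OF r elim] r by (simp add: field_simps)
          from mult_left_mono[OF this, of "\<bar>\<phi> y\<bar>\<^sup>2"] show ?case by simp
        qed
        show "AE y in lebesgue. 0 \<le> \<bar>\<phi> y\<bar>\<^sup>2 * (1 / (2 * pi * r) * circle_potential r y)"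
          using r by (intro AE_I2) (simp add: V)
      qed
    qed
    finally show ?thesis using D by blast
  qed
  show ?thesis
    unfolding c_def[symmetric] using L2 ineq opt strict by blast
qed

end
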